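(* For each $n>1$, there exists a computable stable function $f:[\omega]^n\to\omega$ such that for every positive $i<n$ and every infinite $f$-thin set $X$, there exists a set $B$ which is $\Delta^0_{i+1}$ but not $\Sigma^0_i$, and which is $\Sigma^0_i$ relative to $X$. Hence neither $\mathsf{STS}^n$ nor $\mathsf{TS}^n$ admits preservation of $\Delta^0_{i+1}$-definitions for any positive $i<n$.
   Context: A function $f:[\omega]^n\to\omega$ (elements of $[\omega]^n$ identified with increasing tuples) is stable if $\lim_x f(\sigma,x)$ exists for every $\sigma\in[\omega]^{n-1}$. A set $G$ is $f$-thin if $f([G]^n)\neq\omega$. $\mathsf{TS}^n$ states that every $f:[\omega]^n\to\omega$ has an infinite thin set; $\mathsf{STS}^n$ is $\mathsf{TS}^n$ restricted to stable $f$. For $i>0$, a set is properly $\Delta^0_{i+1}$ relative to $X$ if it is $\Delta^0_{i+1}$ relative to $X$ but neither $\Sigma^0_i$ nor $\Pi^0_i$ relative to $X$; $Y$ preserves $\Delta^0_{i+1}$-definitions relative to $X$ if every properly $\Delta^0_{i+1}$-relative-to-$X$ set is properly $\Delta^0_{i+1}$ relative to $X\oplus Y$. A statement $\Phi=(\forall X)(\exists Y)\varphi(X,Y)$ with $\varphi$ arithmetic admits preservation of $\Delta^0_{i+1}$-definitions if for each $Z$ and each $X\le_T Z$ there exists $Y$ with $\varphi(X,Y)$ such that $Y$ preserves $\Delta^0_{i+1}$-definitions relative to $Z$. *)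

theory Defs
  imports Complex_Main "HOL-Library.Ramsey" "HOL-Library.Nat_Bijection"
begin

(* Kleene's mu-recursive functions with access to a set X of natural numbers:
   Query is the characteristic function of X. Arguments are lists; Zero, Succ and
   Query ignore superfluous arguments, and an application with too few has no value. *)

datatype rec_prog =
    Zero
  | Succ
  | Proj nat
  | Query
  | Comp rec_prog "rec_prog list"
  | Prec rec_prog rec_prog
  | Mu rec_prog

inductive evals :: "nat set \<Rightarrow> rec_prog \<Rightarrow> nat list \<Rightarrow> nat \<Rightarrow> bool" for X :: "nat set" where
  "evals X Zero xs 0"
| "evals X Succ (x # xs) (Suc x)"
| "i < length xs \<Longrightarrow> evals X (Proj i) xs (xs ! i)"
| "evals X Query (x # xs) (of_bool (x \<in> X))"
| "list_all2 (\<lambda>g y. evals X g xs y) gs ys \<Longrightarrow> evals X p ys z \<Longrightarrow> evals X (Comp p gs) xs z"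
| "evals X p xs y \<Longrightarrow> evals X (Prec p q) (0 # xs) y"
| "evals X (Prec p q) (m # xs) r \<Longrightarrow> evals X q (m # r # xs) y
     \<Longrightarrow> evals X (Prec p q) (Suc m # xs) y"
| "evals X p (m # xs) 0 \<Longrightarrow> (\<And>k. k < m \<Longrightarrow> \<exists>y. evals X p (k # xs) (Suc y))
     \<Longrightarrow> evals X (Mu p) xs m"

inductive_cases evals_ZeroE: "evals X Zero xs y"
inductive_cases evals_SuccE: "evals X Succ xs y"
inductive_cases evals_ProjE: "evals X (Proj i) xs y"
inductive_cases evals_QueryE: "evals X Query xs y"
inductive_cases evals_CompE: "evals X (Comp p gs) xs y"
inductive_cases evals_Prec0E: "evals X (Prec p q) (0 # xs) y"
inductive_cases evals_PrecSucE: "evals X (Prec p q) (Suc m # xs) y"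
inductive_cases evals_MuE: "evals X (Mu p) xs y"

lemma evals_functional: "evals X p xs y \<Longrightarrow> evals X p xs z \<Longrightarrow> y = z"
proof (induction arbitrary: z rule: evals.induct)
  case (1 xs)
  then show ?case by (blast elim: evals_ZeroE)
next
  case (2 x xs)
  then show ?case by (auto elim: evals_SuccE)
next
  case (3 i xs)
  then show ?case by (blast elim: evals_ProjE)
next
  case (4 x xs)
  then show ?case by (auto elim: evals_QueryE)
next
  case (5 xs gs ys p w)
  from \<open>evals X (Comp p gs) xs z\<close> obtain ys'
    where ys': "list_all2 (\<lambda>g y. evals X g xs y) gs ys'" "evals X p ys' z"
    by (rule evals_CompE)
  have "ys = ys'"
    using "5.IH"(1) ys'(1) by (auto simp: list_all2_conv_all_nth intro!: nth_equalityI)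
  with "5.IH"(2) ys'(2) show ?case by blast
next
  case (6 p xs y q)
  then show ?case by (blast elim: evals_Prec0E)
next
  case (7 p q m xs r y)
  then show ?case by (blast elim: evals_PrecSucE)
next
  case (8 p m xs)
  from \<open>evals X (Mu p) xs z\<close> have z: "evals X p (z # xs) 0"
    "\<And>k. k < z \<Longrightarrow> \<exists>y. evals X p (k # xs) (Suc y)"
    by (auto elim: evals_MuE)
  have "\<not> z < m"
    using "8.IH"(2) z(1) by (metis nat.distinct(1))
  moreover have "\<not> m < z"
    using "8.IH"(1) z(2) by (metis nat.distinct(1))
  ultimately show ?case by simp
qed

definition turing_le :: "nat set \<Rightarrow> nat set \<Rightarrow> bool"  (infix \<open>\<le>\<^sub>T\<close> 50) where
  "A \<le>\<^sub>T X \<longleftrightarrow> (\<exists>p. \<forall>x. evals X p [x] (of_bool (x \<in> A)))"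

(* Sigma0 i X A: A is Sigma^0_i relative to X. The blocks of quantifiers are peeled
   off one at a time, with tuples coded by the Cantor pairing function. *)

primrec Sigma0 :: "nat \<Rightarrow> nat set \<Rightarrow> nat set \<Rightarrow> bool" where
  "Sigma0 0 X A \<longleftrightarrow> A \<le>\<^sub>T X"
| "Sigma0 (Suc i) X A \<longleftrightarrow> (\<exists>C. Sigma0 i X (- C) \<and> A = {x. \<exists>y. prod_encode (x, y) \<in> C})"

definition Pi0 :: "nat \<Rightarrow> nat set \<Rightarrow> nat set \<Rightarrow> bool" where
  "Pi0 i X A \<longleftrightarrow> Sigma0 i X (- A)"

definition Delta0 :: "nat \<Rightarrow> nat set \<Rightarrow> nat set \<Rightarrow> bool" where
  "Delta0 i X A \<longleftrightarrow> Sigma0 i X A \<and> Pi0 i X A"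

(* The index i stands for "properly Delta^0_(i+1)"; it is used for i > 0 only. *)

definition properly_Delta0_Suc :: "nat \<Rightarrow> nat set \<Rightarrow> nat set \<Rightarrow> bool" where
  "properly_Delta0_Suc i X A \<longleftrightarrow> Delta0 (i + 1) X A \<and> \<not> Sigma0 i X A \<and> \<not> Pi0 i X A"

definition join :: "nat set \<Rightarrow> nat set \<Rightarrow> nat set"  (infixl \<open>\<oplus>\<close> 65) where
  "X \<oplus> Y = (\<lambda>x. 2 * x) ` X \<union> (\<lambda>y. 2 * y + 1) ` Y"

definition preserves_Delta0_Suc :: "nat \<Rightarrow> nat set \<Rightarrow> nat set \<Rightarrow> bool" where
  "preserves_Delta0_Suc i X Y \<longleftrightarrow>
     (\<forall>A. properly_Delta0_Suc i X A \<longrightarrow> properly_Delta0_Suc i (X \<oplus> Y) A)"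

(* A statement (ALL X. EX Y. phi X Y) is represented by its matrix phi. *)

definition admits_preservation_Delta0_Suc ::
    "nat \<Rightarrow> (nat set \<Rightarrow> nat set \<Rightarrow> bool) \<Rightarrow> bool" where
  "admits_preservation_Delta0_Suc i \<phi> \<longleftrightarrow>
     (\<forall>Z X. X \<le>\<^sub>T Z \<longrightarrow> (\<exists>Y. \<phi> X Y \<and> preserves_Delta0_Suc i Z Y))"

(* A function on n-element sets of natural numbers is given by a total f :: nat set => nat,
   of which only the values on nsets UNIV n matter. *)

definition computable_on_nsets :: "nat \<Rightarrow> (nat set \<Rightarrow> nat) \<Rightarrow> bool" where
  "computable_on_nsets n f \<longleftrightarrow>
     (\<exists>p. \<forall>\<sigma> \<in> nsets UNIV n. evals {} p (sorted_list_of_set \<sigma>) (f \<sigma>))"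

(* Convergence is in the discrete topology of nat, and insert x \<sigma> is the tuple (\<sigma>, x)
   for all but finitely many x. *)

definition stable_on_nsets :: "nat \<Rightarrow> (nat set \<Rightarrow> nat) \<Rightarrow> bool" where
  "stable_on_nsets n f \<longleftrightarrow> (\<forall>\<sigma> \<in> nsets UNIV (n - 1). convergent (\<lambda>x. f (insert x \<sigma>)))"

definition thin :: "nat \<Rightarrow> (nat set \<Rightarrow> nat) \<Rightarrow> nat set \<Rightarrow> bool" where
  "thin n f G \<longleftrightarrow> f ` nsets G n \<noteq> UNIV"

definition graph_code :: "nat \<Rightarrow> (nat set \<Rightarrow> nat) \<Rightarrow> nat set" where
  "graph_code n f =
     (\<lambda>\<sigma>. prod_encode (list_encode (sorted_list_of_set \<sigma>), f \<sigma>)) ` nsets UNIV n"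

(* Matrices of the two principles: any Y is a solution of an X coding no function. *)

definition TS :: "nat \<Rightarrow> nat set \<Rightarrow> nat set \<Rightarrow> bool" where
  "TS n X Y \<longleftrightarrow> (\<forall>f. X = graph_code n f \<longrightarrow> infinite Y \<and> thin n f Y)"

definition STS :: "nat \<Rightarrow> nat set \<Rightarrow> nat set \<Rightarrow> bool" where
  "STS n X Y \<longleftrightarrow> (\<forall>f. stable_on_nsets n f \<and> X = graph_code n f \<longrightarrow> infinite Y \<and> thin n f Y)"

end

theory Submission
  imports Defs
begin

text \<open>For every level \<open>i\<close> a finite injury construction assigns to each stage one color, and yields
  for every color \<open>c\<close> a set \<open>T\<^sub>c\<close> that is \<open>\<Delta>\<close> of level \<open>i + 1\<close> but not \<open>\<Sigma>\<close> of level \<open>i\<close>, together with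
  approximations of level \<open>i\<close>. At stage \<open>x\<close> the approximation to \<open>T\<^sub>c\<close> can wrongly contain a number
  \<open>k \<le> x\<close> only if \<open>x\<close> has color \<open>c\<close>; so an infinite set of stages that misses \<open>c\<close> enumerates \<open>T\<^sub>c\<close>.
  This works because the witness of a requirement acting at \<open>s\<close> is removed from \<open>T\<^sub>c\<close> at the cost of
  giving color \<open>c\<close> to the stages between the witness and \<open>s\<close>, and all weaker witnesses are moved
  beyond \<open>s\<close>, which keeps the colored blocks disjoint.

  All levels are then coded into one function by iterated limits. Starting with the coloring of the
  top level, the limit lemma represents a function of \<open>m\<close> variables as the limit of one of \<open>m + 1\<close>
  variables and of lower complexity. The latter is overwritten by the color of its last argument
  when the block of that argument starts below the last but one argument. This happens only
  finitely often for fixed initial arguments, so the limit is not changed.\<close>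

subsection \<open>Computable functions\<close>

abbreviation pair :: "nat \<Rightarrow> nat \<Rightarrow> nat" where "pair a b \<equiv> prod_encode (a, b)"
definition p1 :: "nat \<Rightarrow> nat" where "p1 z = fst (prod_decode z)"
definition p2 :: "nat \<Rightarrow> nat" where "p2 z = snd (prod_decode z)"

lemma p1_pair [simp]: "p1 (pair a b) = a" and p2_pair [simp]: "p2 (pair a b) = b"
  by (simp_all add: p1_def p2_def)

lemma pair_p1_p2 [simp]: "pair (p1 z) (p2 z) = z"
  by (simp add: p1_def p2_def)

definition computable :: "nat set \<Rightarrow> (nat \<Rightarrow> nat) \<Rightarrow> bool" where
  "computable X f \<longleftrightarrow> (\<exists>p. \<forall>x. evals X p [x] (f x))"

definition computable2 :: "nat set \<Rightarrow> (nat \<Rightarrow> nat \<Rightarrow> nat) \<Rightarrow> bool" where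
  "computable2 X f \<longleftrightarrow> (\<exists>p. \<forall>x y. evals X p [x, y] (f x y))"

lemma evals_Comp1: "evals X q xs y \<Longrightarrow> evals X p [y] z \<Longrightarrow> evals X (Comp p [q]) xs z"
  by (rule evals.intros(5)[of _ _ _ "[y]"]) auto

lemma evals_Comp2:
  "evals X q xs y \<Longrightarrow> evals X q' xs y' \<Longrightarrow> evals X p [y, y'] z \<Longrightarrow> evals X (Comp p [q, q']) xs z"
  by (rule evals.intros(5)[of _ _ _ "[y, y']"]) auto

lemma evals_Proj: "i < length xs \<Longrightarrow> xs ! i = y \<Longrightarrow> evals X (Proj i) xs y"
  using evals.intros(3) by blast

lemma evals_Proj0: "evals X (Proj 0) (x # xs) x"
  and evals_Proj1: "evals X (Proj (Suc 0)) (x # y # xs) y"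
  and evals_Proj2: "evals X (Proj 2) (x # y # z # xs) z"
  by (simp_all add: evals_Proj)

lemmas evals_basic = evals.intros(1,2) evals_Proj0 evals_Proj1 evals_Proj2 evals_Comp1 evals_Comp2

lemma evals_Prec:
  assumes "evals X p xs (f 0)" "\<And>m. evals X q (m # f m # xs) (f (Suc m))"
  shows "evals X (Prec p q) (m # xs) (f m)"
  by (induction m) (auto intro: evals.intros assms)

lemma computable_id: "computable X (\<lambda>e. e)"
  unfolding computable_def by (rule exI[of _ "Proj 0"]) (simp add: evals_Proj)

lemma evals_const: "\<exists>p. \<forall>xs. evals X p xs c"
proof (induction c)
  case 0
  then show ?case by (auto intro: evals.intros)
next
  case (Suc c)
  then obtain p where "\<forall>xs. evals X p xs c" by blast
  then have "\<forall>xs. evals X (Comp Succ [p]) xs (Suc c)"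
    by (auto intro: evals_Comp1 evals.intros)
  then show ?case by blast
qed

lemma computable_const: "computable X (\<lambda>e. c)"
  unfolding computable_def using evals_const by blast

lemma computable_comp: "computable X f \<Longrightarrow> computable X g \<Longrightarrow> computable X (\<lambda>e. f (g e))"
  unfolding computable_def by (meson evals_Comp1)

lemma computable2_comp:
  "computable2 X f \<Longrightarrow> computable X g \<Longrightarrow> computable X h \<Longrightarrow> computable X (\<lambda>e. f (g e) (h e))"
  unfolding computable_def computable2_def by (meson evals_Comp2)

abbreviation add_prog :: rec_prog where
  "add_prog \<equiv> Prec (Proj 0) (Comp Succ [Proj (Suc 0)])"

lemma evals_add: "evals X add_prog [m, x] (m + x)"
  by (rule evals_Prec; simp; (rule evals_basic)+)

lemma computable2_add: "computable2 X (+)"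
  unfolding computable2_def using evals_add by blast

lemma computable2_mult: "computable2 X (*)"
proof -
  have "evals X (Prec Zero (Comp add_prog [Proj 2, Proj (Suc 0)])) [m, x] (m * x)" for m x
    by (rule evals_Prec; simp; (rule evals_basic evals_add)+)
  then show ?thesis unfolding computable2_def by blast
qed

lemma computable2_diff: "computable2 X (-)"
proof -
  have pred: "evals X (Prec Zero (Proj 0)) [m] (m - 1)" for m
    by (rule evals_Prec; simp; (rule evals_basic)+)
  \<comment> \<open>Recursion runs on the first argument, so this program takes the subtrahend
    first; the arguments are swapped at the end.\<close>
  define p where "p = Prec (Proj 0) (Comp (Prec Zero (Proj 0)) [Proj (Suc 0)])"
  have step: "evals X (Comp (Prec Zero (Proj 0)) [Proj (Suc 0)]) (m # (x - m) # xs) (x - Suc m)" for m x xs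
    using evals_Comp1[OF evals_Proj1 pred[of "x - m"]] by simp
  have "evals X p [m, x] (x - m)" for m x
    unfolding p_def by (rule evals_Prec) (simp_all add: evals_Proj0 step)
  then have "evals X (Comp p [Proj (Suc 0), Proj 0]) [x, m] (x - m)" for m x
    by (meson evals_basic)
  then show ?thesis unfolding computable2_def by blast
qed

lemmas computable_add = computable2_comp[OF computable2_add]
lemmas computable_mult = computable2_comp[OF computable2_mult]
lemmas computable_diff = computable2_comp[OF computable2_diff]

lemma computable_Suc: "computable X f \<Longrightarrow> computable X (\<lambda>e. Suc (f e))"
  using computable_add[OF _ computable_const[of X 1]] by simp

lemma computable_power2: "computable X f \<Longrightarrow> computable X (\<lambda>e. 2 ^ f e)"
proof (rule computable_comp[of X "\<lambda>e. 2 ^ e"])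
  obtain p where p: "\<And>xs. evals X p xs 1" using evals_const by blast
  have "evals X (Prec p (Comp add_prog [Proj (Suc 0), Proj (Suc 0)])) [m] (2 ^ m)" for m
    by (rule evals_Prec; simp add: mult_2; (rule evals_basic evals_add p[simplified])+)
  then show "computable X (\<lambda>e. 2 ^ e)" unfolding computable_def by blast
qed

lemma computable_triangle: "computable X f \<Longrightarrow> computable X (\<lambda>e. triangle (f e))"
proof (rule computable_comp[of X triangle])
  have "evals X (Prec Zero (Comp Succ [Comp add_prog [Proj (Suc 0), Proj 0]])) [m] (triangle m)" for m
    by (rule evals_Prec; simp; (rule evals_basic evals_add)+)
  then show "computable X triangle" unfolding computable_def by blast
qed

lemma computable_pair: 
  "computable X f \<Longrightarrow> computable X g \<Longrightarrow> computable X (\<lambda>e. pair (f e) (g e))"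
  unfolding prod_encode_def by (simp add: computable_add computable_triangle)

lemma computable2_Proj: "computable2 X (\<lambda>a b. a)" "computable2 X (\<lambda>a b. b)"
  unfolding computable2_def by (blast intro: evals_Proj0 evals_Proj1)+

lemma computable2_op:
  "computable2 X h \<Longrightarrow> computable2 X f \<Longrightarrow> computable2 X g \<Longrightarrow> computable2 X (\<lambda>a b. h (f a b) (g a b))"
  unfolding computable2_def by (meson evals_Comp2)

lemma computable2_apply: "computable X h \<Longrightarrow> computable2 X f \<Longrightarrow> computable2 X (\<lambda>a b. h (f a b))"
  unfolding computable_def computable2_def by (meson evals_Comp1)

lemmas computable2_triangle = computable2_apply[OF computable_triangle[OF computable_id]]
lemmas computable2_Suc = computable2_apply[OF computable_Suc[OF computable_id]]

lemma computable2_pairI: "computable X f \<Longrightarrow> computable2 X (\<lambda>a b. f (pair a b))"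
  unfolding prod_encode_def prod.case
  by (erule computable2_apply) (intro computable2_op[OF computable2_add] computable2_triangle computable2_Proj)

text \<open>The binary form lets \<open>Mu\<close> search without decoding pairs, so that it is
  available for computing the projections \<open>p1\<close> and \<open>p2\<close>.\<close>

lemma computable_Least_zero2:
  assumes "computable2 X f" "\<And>e. \<exists>m. f m e = 0"
  shows "computable X (\<lambda>e. LEAST m. f m e = 0)"
proof -
  obtain p where p: "evals X p [m, e] (f m e)" for m e
    using assms(1) unfolding computable2_def by blast
  have "evals X (Mu p) [e] (LEAST m. f m e = 0)" for e
  proof (rule evals.intros)
    show "evals X p [LEAST m. f m e = 0, e] 0"
      using p[of "LEAST m. f m e = 0" e] LeastI_ex[OF assms(2)[of e]] by simp
    show "\<exists>y. evals X p [k, e] (Suc y)" if "k < (LEAST m. f m e = 0)" for k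
      using p[of k e] not_less_Least[OF that] by (metis not0_implies_Suc)
  qed
  then show ?thesis unfolding computable_def by blast
qed

lemma le_triangle: "n \<le> triangle n"
  by (induction n) auto

lemma triangle_mono: "m \<le> n \<Longrightarrow> triangle m \<le> triangle n"
  by (induction n) (auto simp: le_Suc_eq)

lemma computable_p1_p2: "computable X p1" "computable X p2"
proof -
  \<comment> \<open>With truncated subtraction this is the least \<open>w\<close> with
    \<open>z < triangle (Suc w)\<close>: the Cantor diagonal on which \<open>z\<close> lies, hence
    the sum of its two components.\<close>
  define w where "w z = (LEAST w. Suc z - triangle (Suc w) = 0)" for z
  have "computable2 X (\<lambda>m e. Suc e - triangle (Suc m))"
    by (intro computable2_op[OF computable2_diff] computable2_triangle computable2_Suc computable2_Proj)
  moreover have "\<exists>m. Suc e - triangle (Suc m) = 0" for e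
    using le_triangle[of "Suc e"] by (intro exI[of _ e]) (simp del: triangle_Suc)
  ultimately have w: "computable X w" unfolding w_def by (rule computable_Least_zero2)
  have weq: "w z = p1 z + p2 z" for z
  proof -
    have z: "z = triangle (p1 z + p2 z) + p1 z"
      using pair_p1_p2[of z] by (simp add: prod_encode_def)
    show ?thesis unfolding w_def
    proof (rule Least_equality)
      show "Suc z - triangle (Suc (p1 z + p2 z)) = 0" using z by simp
      fix y assume "Suc z - triangle (Suc y) = 0"
      then have "Suc z \<le> triangle (Suc y)" by simp
      then show "p1 z + p2 z \<le> y"
        using z triangle_mono[of "Suc y" "p1 z + p2 z"] by linarith
    qed
  qed
  have p1: "p1 = (\<lambda>z. z - triangle (w z))"
  proof
    fix z
    show "p1 z = z - triangle (w z)"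
      using pair_p1_p2[of z] by (simp add: weq prod_encode_def)
  qed
  have p2: "p2 = (\<lambda>z. w z - (z - triangle (w z)))"
  proof
    fix z
    show "p2 z = w z - (z - triangle (w z))"
      using fun_cong[OF p1, of z] weq[of z] by linarith
  qed
  show "computable X p1" by (subst p1) (intro computable_diff computable_triangle w computable_id)
  show "computable X p2" by (subst p2) (intro computable_diff computable_triangle w computable_id)
qed

lemmas computable_p1 = computable_comp[OF computable_p1_p2(1)]
lemmas computable_p2 = computable_comp[OF computable_p1_p2(2)]

lemmas computable_intros = computable_id computable_const computable_add computable_mult
  computable_diff computable_Suc computable_power2 computable_pair computable_p1 computable_p2

section \<open>Decidable predicates\<close>

definition decidable :: "nat set \<Rightarrow> (nat \<Rightarrow> bool) \<Rightarrow> bool" where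
  "decidable X P \<longleftrightarrow> computable X (\<lambda>e. of_bool (P e))"

lemma decidable_subst: "decidable X P \<Longrightarrow> computable X f \<Longrightarrow> decidable X (\<lambda>e. P (f e))"
  unfolding decidable_def by (rule computable_comp)

lemma decidable_conj: "decidable X P \<Longrightarrow> decidable X Q \<Longrightarrow> decidable X (\<lambda>e. P e \<and> Q e)"
  using computable_mult[of X "\<lambda>e. of_bool (P e)" "\<lambda>e. of_bool (Q e)"]
  by (simp add: decidable_def of_bool_conj)

lemma decidable_less: "computable X f \<Longrightarrow> computable X g \<Longrightarrow> decidable X (\<lambda>e. f e < g e)"
proof -
  assume "computable X f" "computable X g"
  then have "computable X (\<lambda>e. Suc 0 - (Suc (f e) - g e))"
    by (intro computable_intros)
  moreover have "(\<lambda>e. Suc 0 - (Suc (f e) - g e)) = (\<lambda>e. of_bool (f e < g e))"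
    by auto
  ultimately show ?thesis unfolding decidable_def by simp
qed

lemma decidable_not: "decidable X P \<Longrightarrow> decidable X (\<lambda>e. \<not> P e)"
  using decidable_less[of X "\<lambda>e. of_bool (P e)" "\<lambda>_. 1"] computable_const
  by (simp add: decidable_def)

lemma decidable_disj: "decidable X P \<Longrightarrow> decidable X Q \<Longrightarrow> decidable X (\<lambda>e. P e \<or> Q e)"
  using decidable_not[OF decidable_conj[OF decidable_not decidable_not]] by simp

lemma decidable_eq: "computable X f \<Longrightarrow> computable X g \<Longrightarrow> decidable X (\<lambda>e. f e = g e)"
  using decidable_conj[OF decidable_not[OF decidable_less[of X f g]] decidable_not[OF decidable_less[of X g f]]]
  by (simp add: not_less eq_iff conj_commute)

lemma computable_Least:
  assumes "decidable X P" "\<And>e. \<exists>m. P (pair m e)"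
  shows "computable X (\<lambda>e. LEAST m. P (pair m e))"
proof -
  have "computable2 X (\<lambda>m e. of_bool (\<not> P (pair m e)))"
    using computable2_pairI[OF decidable_not[OF assms(1), unfolded decidable_def]] by simp
  from computable_Least_zero2[OF this] show ?thesis using assms(2) by simp
qed

lemma decidable_bex:
  assumes "decidable X P" 
  shows "decidable X (\<lambda>z. \<exists>k<p1 z. P (pair k (p2 z)))"
proof -
  \<comment> \<open>The disjunct \<open>k = p1 z\<close> makes the search total; the bound itself is
    returned exactly when no smaller witness exists.\<close>
  let ?L = "\<lambda>z. LEAST k. P (pair k (p2 z)) \<or> k = p1 z"
  have "computable X ?L"
  proof -
    have "decidable X (\<lambda>w. P (pair (p1 w) (p2 (p2 w))) \<or> p1 w = p1 (p2 w))"
      by (intro decidable_disj decidable_eq decidable_subst[OF assms] computable_intros)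
    from computable_Least[OF this] show ?thesis by auto
  qed
  then have "decidable X (\<lambda>z. ?L z < p1 z)"
    by (intro decidable_less computable_intros)
  moreover have "(?L z < p1 z) = (\<exists>k<p1 z. P (pair k (p2 z)))" for z
  proof
    assume *: "?L z < p1 z"
    have "P (pair (?L z) (p2 z)) \<or> ?L z = p1 z" by (rule LeastI_ex) blast
    with * show "\<exists>k<p1 z. P (pair k (p2 z))" by auto
  next
    assume "\<exists>k<p1 z. P (pair k (p2 z))"
    then obtain k where "k < p1 z" "P (pair k (p2 z))" by blast
    then show "?L z < p1 z" using Least_le[of "\<lambda>k. P (pair k (p2 z)) \<or> k = p1 z" k] by simp
  qed
  ultimately show ?thesis by simp
qed

subsection \<open>The arithmetical hierarchy\<close>

text \<open>Stated for predicates, so that the closure rules can follow the shape of lambda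
  terms.\<close>

definition sigma :: "nat set \<Rightarrow> nat \<Rightarrow> (nat \<Rightarrow> bool) \<Rightarrow> bool" where
  "sigma X i P \<longleftrightarrow> Sigma0 i X {e. P e}"

lemma sigma_0: "sigma X 0 P \<longleftrightarrow> decidable X P"
  by (simp add: sigma_def turing_le_def decidable_def computable_def)

lemma sigma_Suc: "sigma X (Suc i) P \<longleftrightarrow> (\<exists>Q. sigma X i (\<lambda>e. \<not> Q e) \<and> P = (\<lambda>x. \<exists>y. Q (pair x y)))"
proof
  assume "sigma X (Suc i) P"
  then obtain C where "Sigma0 i X (- C)" "{e. P e} = {x. \<exists>y. pair x y \<in> C}"
    unfolding sigma_def by auto
  then show "\<exists>Q. sigma X i (\<lambda>e. \<not> Q e) \<and> P = (\<lambda>x. \<exists>y. Q (pair x y))"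
    by (intro exI[of _ "\<lambda>e. e \<in> C"]) (auto simp: sigma_def Compl_eq fun_eq_iff set_eq_iff)
next
  assume "\<exists>Q. sigma X i (\<lambda>e. \<not> Q e) \<and> P = (\<lambda>x. \<exists>y. Q (pair x y))"
  then obtain Q where "sigma X i (\<lambda>e. \<not> Q e)" "P = (\<lambda>x. \<exists>y. Q (pair x y))" by blast
  then show "sigma X (Suc i) P"
    unfolding sigma_def Sigma0.simps by (intro exI[of _ "{e. Q e}"]) (auto simp: Compl_eq)
qed

lemma sigma_SucI: "sigma X i (\<lambda>e. \<not> Q e) \<Longrightarrow> sigma X (Suc i) (\<lambda>x. \<exists>y. Q (pair x y))"
  using sigma_Suc by blast

lemma sigma_SucE:
  assumes "sigma X (Suc i) P"
  obtains Q where "sigma X i (\<lambda>e. \<not> Q e)" "\<And>x. P x \<longleftrightarrow> (\<exists>y. Q (pair x y))"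
  using assms unfolding sigma_Suc by auto

lemma sigma_subst: "sigma X i P \<Longrightarrow> computable X f \<Longrightarrow> sigma X i (\<lambda>e. P (f e))"
proof (induction i arbitrary: P f)
  case 0
  then show ?case by (simp add: sigma_0 decidable_subst)
next
  case (Suc i)
  then obtain Q where Q: "sigma X i (\<lambda>e. \<not> Q e)" "\<And>x. P x \<longleftrightarrow> (\<exists>y. Q (pair x y))"
    by (elim sigma_SucE) blast
  have "sigma X i (\<lambda>z. \<not> Q (pair (f (p1 z)) (p2 z)))"
    by (rule Suc.IH[OF Q(1)])
       (intro computable_pair computable_p2 computable_id computable_comp[OF Suc.prems(2)] computable_p1)
  from sigma_SucI[OF this] show ?case by (simp add: Q(2))
qed

text \<open>\<open>P\<close> is read from the first component of the pair, under a dummy existential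
  quantifier.\<close>

lemma sigma_Suc_of_not: "sigma X i (\<lambda>e. \<not> P e) \<Longrightarrow> sigma X (Suc i) P"
  using sigma_SucI[OF sigma_subst[of X i "\<lambda>e. \<not> P e" p1]] computable_p1_p2 by simp

lemma sigma_up: "sigma X i P \<Longrightarrow> sigma X (Suc i) P"
proof (induction i arbitrary: P)
  case 0
  then show ?case by (intro sigma_Suc_of_not) (simp add: sigma_0 decidable_not)
next
  case (Suc i)
  then obtain Q where Q: "sigma X i (\<lambda>e. \<not> Q e)" "\<And>x. P x \<longleftrightarrow> (\<exists>y. Q (pair x y))"
    by (elim sigma_SucE) blast
  have "sigma X (Suc i) (\<lambda>e. \<not> Q e)" by (rule Suc.IH[OF Q(1)])
  from sigma_SucI[OF this] show ?case by (simp add: Q(2))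
qed

text \<open>The matrix of a Sigma predicate of level \<open>Suc i\<close> is the complement of one
  of level \<open>i\<close>, so each connective uses the induction hypothesis for the other one;
  both are therefore proved together. A pair of witnesses serves both predicates.\<close>

lemma sigma_conj_disj:
  "sigma X i P \<Longrightarrow> sigma X i Q \<Longrightarrow> sigma X i (\<lambda>e. P e \<and> Q e) \<and> sigma X i (\<lambda>e. P e \<or> Q e)"
proof (induction i arbitrary: P Q)
  case 0
  then show ?case by (simp add: sigma_0 decidable_conj decidable_disj)
next
  case (Suc i)
  from Suc.prems obtain P' Q'
    where P': "sigma X i (\<lambda>e. \<not> P' e)" "\<And>x. P x \<longleftrightarrow> (\<exists>y. P' (pair x y))"
      and Q': "sigma X i (\<lambda>e. \<not> Q' e)" "\<And>x. Q x \<longleftrightarrow> (\<exists>y. Q' (pair x y))"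
    by (elim sigma_SucE) blast
  let ?P = "\<lambda>z. P' (pair (p1 z) (p1 (p2 z)))" and ?Q = "\<lambda>z. Q' (pair (p1 z) (p2 (p2 z)))"
  have *: "sigma X i (\<lambda>z. \<not> ?P z)" "sigma X i (\<lambda>z. \<not> ?Q z)"
    by (intro sigma_subst[OF P'(1)] sigma_subst[OF Q'(1)] computable_intros)+
  have "sigma X i (\<lambda>z. \<not> (?P z \<and> ?Q z))" "sigma X i (\<lambda>z. \<not> (?P z \<or> ?Q z))"
    using Suc.IH[OF *] by simp_all
  from this[THEN sigma_SucI]
  have "sigma X (Suc i) (\<lambda>x. \<exists>y. ?P (pair x y) \<and> ?Q (pair x y))"
    "sigma X (Suc i) (\<lambda>x. \<exists>y. ?P (pair x y) \<or> ?Q (pair x y))" .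
  moreover have "(\<exists>y. ?P (pair x y) \<and> ?Q (pair x y)) \<longleftrightarrow> P x \<and> Q x" for x
  proof
    assume "P x \<and> Q x"
    then obtain y y' where "P' (pair x y)" "Q' (pair x y')" by (auto simp: P' Q')
    then show "\<exists>y. ?P (pair x y) \<and> ?Q (pair x y)" by (intro exI[of _ "pair y y'"]) simp
  qed (auto simp: P' Q')
  moreover have "(\<exists>y. ?P (pair x y) \<or> ?Q (pair x y)) \<longleftrightarrow> P x \<or> Q x" for x
  proof
    assume "P x \<or> Q x"
    then obtain y where "P' (pair x y) \<or> Q' (pair x y)" by (auto simp: P' Q')
    then show "\<exists>y. ?P (pair x y) \<or> ?Q (pair x y)" by (intro exI[of _ "pair y y"]) simp
  qed (auto simp: P' Q')
  ultimately show ?case by simp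
qed

lemmas sigma_conj = sigma_conj_disj[THEN conjunct1]
lemmas sigma_disj = sigma_conj_disj[THEN conjunct2]

text \<open>Two existential quantifiers merge into one whose variable codes a pair of
  witnesses.\<close>

lemma sigma_ex_pair:
  assumes "sigma X (Suc i) P"
  shows "sigma X (Suc i) (\<lambda>e. \<exists>y. P (pair e y))"
proof -
  from assms obtain Q where Q: "sigma X i (\<lambda>e. \<not> Q e)" "\<And>x. P x \<longleftrightarrow> (\<exists>y. Q (pair x y))"
    by (elim sigma_SucE) blast
  have "sigma X i (\<lambda>z. \<not> Q (pair (pair (p1 z) (p1 (p2 z))) (p2 (p2 z))))"
    by (intro sigma_subst[OF Q(1)] computable_intros)
  from sigma_SucI[OF this]
  have "sigma X (Suc i) (\<lambda>x. \<exists>y. Q (pair (pair x (p1 y)) (p2 y)))" by simp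
  moreover have "(\<exists>y. Q (pair (pair x (p1 y)) (p2 y))) \<longleftrightarrow> (\<exists>y. P (pair x y))" for x
    unfolding Q(2) by (metis p1_pair p2_pair)
  ultimately show ?thesis by simp
qed

lemma ball_ex_less_iff: "(\<forall>k<b::nat. \<exists>y. P k y) \<longleftrightarrow> (\<exists>s::nat. \<forall>k<b. \<exists>y<s. P k y)"
proof
  assume "\<forall>k<b. \<exists>y. P k y"
  then obtain f where "\<forall>k<b. P k (f k)" by metis
  then show "\<exists>s. \<forall>k<b. \<exists>y<s. P k y"
    by (intro exI[of _ "Suc (Max (f ` {..<b}))"]) (auto intro!: exI[of _ "f _"] simp: less_Suc_eq_le)
qed blast

text \<open>For the universal quantifier in the successor step, the witnesses are collected below a
  common bound, so that the unbounded quantifier moves to the front.\<close>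

lemma sigma_bounded:
  "sigma X i P \<Longrightarrow> sigma X i (\<lambda>z. \<forall>k<p1 z. P (pair k (p2 z))) \<and> sigma X i (\<lambda>z. \<exists>k<p1 z. P (pair k (p2 z)))"
proof (induction i arbitrary: P)
  case 0
  then show ?case
    using decidable_bex[of X P] decidable_not[OF decidable_bex[OF decidable_not[of X P]]]
    by (simp add: sigma_0)
next
  case (Suc i)
  then obtain Q where Q: "sigma X i (\<lambda>e. \<not> Q e)" "\<And>x. P x \<longleftrightarrow> (\<exists>y. Q (pair x y))"
    by (elim sigma_SucE) blast
  \<comment> \<open>The two existential quantifiers commute; after that the complement of the matrix
    is a bounded universal statement of level \<open>i\<close>.\<close>
  have "sigma X i (\<lambda>w. \<not> Q (pair (pair (p1 w) (p1 (p2 w))) (p2 (p2 w))))"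
    by (intro sigma_subst[OF Q(1)] computable_intros)
  from Suc.IH[OF this, THEN conjunct1]
  have "sigma X i (\<lambda>z. \<forall>k<p1 z. \<not> Q (pair (pair k (p1 (p2 z))) (p2 (p2 z))))" by simp
  from sigma_subst[OF this, of "\<lambda>z. pair (p1 (p1 z)) (pair (p2 (p1 z)) (p2 z))"]
  have "sigma X i (\<lambda>z. \<forall>k<p1 (p1 z). \<not> Q (pair (pair k (p2 (p1 z))) (p2 z)))"
    by (simp add: computable_intros)
  then have "sigma X i (\<lambda>z. \<not> (\<exists>k<p1 (p1 z). Q (pair (pair k (p2 (p1 z))) (p2 z))))" by simp
  from sigma_SucI[OF this]
  have "sigma X (Suc i) (\<lambda>x. \<exists>y. \<exists>k<p1 x. Q (pair (pair k (p2 x)) y))" by simp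
  moreover have "(\<exists>y. \<exists>k<p1 x. Q (pair (pair k (p2 x)) y)) \<longleftrightarrow> (\<exists>k<p1 x. P (pair k (p2 x)))" for x
    unfolding Q(2) by blast
  ultimately have ex: "sigma X (Suc i) (\<lambda>x. \<exists>k<p1 x. P (pair k (p2 x)))" by simp
  \<comment> \<open>The complement of the new matrix is a bounded existential quantifier over a
    bounded universal one, so both halves of the induction hypothesis are applied in turn.\<close>
  have "sigma X i (\<lambda>w. \<not> Q (pair (p2 w) (p1 w)))"
    by (intro sigma_subst[OF Q(1)] computable_intros)
  from Suc.IH[OF this, THEN conjunct1]
  have "sigma X i (\<lambda>z. \<forall>y<p1 z. \<not> Q (pair (p2 z) y))" by simp
  from sigma_subst[OF this, of "\<lambda>z. pair (p2 (p2 z)) (pair (p1 z) (p1 (p2 z)))"]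
  have "sigma X i (\<lambda>z. \<forall>y<p2 (p2 z). \<not> Q (pair (pair (p1 z) (p1 (p2 z))) y))"
    by (simp add: computable_intros)
  from Suc.IH[OF this, THEN conjunct2]
  have "sigma X i (\<lambda>z. \<exists>k<p1 z. \<forall>y<p2 (p2 z). \<not> Q (pair (pair k (p1 (p2 z))) y))" by simp
  from sigma_subst[OF this, of "\<lambda>z. pair (p1 (p1 z)) (pair (p2 (p1 z)) (p2 z))"]
  have "sigma X i (\<lambda>z. \<not> (\<forall>k<p1 (p1 z). \<exists>y<p2 z. Q (pair (pair k (p2 (p1 z))) y)))"
    by (simp add: computable_intros)
  from sigma_SucI[OF this]
  have "sigma X (Suc i) (\<lambda>x. \<exists>s. \<forall>k<p1 x. \<exists>y<s. Q (pair (pair k (p2 x)) y))" by simp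
  then have "sigma X (Suc i) (\<lambda>x. \<forall>k<p1 x. P (pair k (p2 x)))"
    unfolding ball_ex_less_iff[symmetric] Q(2) .
  with ex show ?case by blast
qed

section \<open>Delta predicates and functions with Delta graphs\<close>

definition delta :: "nat set \<Rightarrow> nat \<Rightarrow> (nat \<Rightarrow> bool) \<Rightarrow> bool" where
  "delta X i P \<longleftrightarrow> sigma X i P \<and> sigma X i (\<lambda>e. \<not> P e)"

text \<open>A Sigma graph is enough: for a total function at a positive level the complement of the
  graph is then Sigma as well, because a pair lies outside exactly when another value is
  taken.\<close>

definition delta_fun :: "nat set \<Rightarrow> nat \<Rightarrow> (nat \<Rightarrow> nat) \<Rightarrow> bool" where
  "delta_fun X i f \<longleftrightarrow> sigma X i (\<lambda>z. f (p1 z) = p2 z)"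

lemma delta_sigma: "delta X i P \<Longrightarrow> sigma X i P"
  and delta_sigma_not: "delta X i P \<Longrightarrow> sigma X i (\<lambda>e. \<not> P e)"
  by (simp_all add: delta_def)

lemma decidable_imp_delta: "decidable X P \<Longrightarrow> delta X i P"
proof -
  assume "decidable X P"
  then have "delta X 0 P" by (simp add: delta_def sigma_0 decidable_not)
  then show ?thesis by (induction i) (auto simp: delta_def intro: sigma_up)
qed

lemma sigma_imp_delta_Suc: "sigma X i P \<Longrightarrow> delta X (Suc i) P"
  using sigma_up[of X i P] sigma_Suc_of_not[of X i "\<lambda>e. \<not> P e"] by (simp add: delta_def)

lemma computable_imp_delta_fun:
  assumes "computable X f"
  shows "delta_fun X i f"
  unfolding delta_fun_def
  by (intro delta_sigma[OF decidable_imp_delta] decidable_eq computable_p2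
      computable_comp[OF assms] computable_p1 computable_id)

text \<open>\<open>P (f e)\<close> says that some \<open>y\<close> satisfies both
  \<open>f e = y\<close> and \<open>P y\<close>; the extra existential quantifier is absorbed at
  positive levels.\<close>

lemma sigma_subst_fun:
  assumes P: "sigma X (Suc i) P" and f: "delta_fun X (Suc i) f"
  shows "sigma X (Suc i) (\<lambda>e. P (f e))"
proof -
  have "sigma X (Suc i) (\<lambda>z. f (p1 z) = p2 z \<and> P (p2 z))"
    by (intro sigma_conj f[unfolded delta_fun_def] sigma_subst[OF P] computable_p2 computable_id)
  from sigma_ex_pair[OF this] show ?thesis by simp
qed

lemma delta_subst:
  "delta X (Suc i) P \<Longrightarrow> delta_fun X (Suc i) f \<Longrightarrow> delta X (Suc i) (\<lambda>e. P (f e))"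
  unfolding delta_def using sigma_subst_fun[of X i "\<lambda>e. \<not> P e" f] by (simp add: sigma_subst_fun)

lemma delta_fun_comp:
  assumes "delta_fun X (Suc i) h" "delta_fun X (Suc i) f"
  shows "delta_fun X (Suc i) (\<lambda>e. h (f e))"
proof -
  have "sigma X (Suc i) (\<lambda>z. f (p1 (p1 z)) = p2 z \<and> h (p2 z) = p2 (p1 z))"
    using sigma_subst[OF assms(1)[unfolded delta_fun_def], of "\<lambda>z. pair (p2 z) (p2 (p1 z))"]
      sigma_subst[OF assms(2)[unfolded delta_fun_def], of "\<lambda>z. pair (p1 (p1 z)) (p2 z)"]
    by (intro sigma_conj) (simp_all add: computable_intros)
  from sigma_ex_pair[OF this] show ?thesis by (simp add: delta_fun_def)
qed

lemma delta_fun_pair: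
  assumes "delta_fun X (Suc i) f" "delta_fun X (Suc i) g"
  shows "delta_fun X (Suc i) (\<lambda>e. pair (f e) (g e))"
proof -
  have "sigma X (Suc i) (\<lambda>z. f (p1 z) = p1 (p2 z) \<and> g (p1 z) = p2 (p2 z))"
    using sigma_subst[OF assms(1)[unfolded delta_fun_def], of "\<lambda>z. pair (p1 z) (p1 (p2 z))"]
      sigma_subst[OF assms(2)[unfolded delta_fun_def], of "\<lambda>z. pair (p1 z) (p2 (p2 z))"]
    by (intro sigma_conj) (simp_all add: computable_intros)
  moreover have "(pair (f (p1 z)) (g (p1 z)) = p2 z) = (f (p1 z) = p1 (p2 z) \<and> g (p1 z) = p2 (p2 z))" for z
    by (metis p1_pair p2_pair pair_p1_p2)
  ultimately show ?thesis by (simp add: delta_fun_def)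
qed

lemma delta_fun_comp2:
  assumes "delta_fun X (Suc i) (\<lambda>z. h (p1 z) (p2 z))" "delta_fun X (Suc i) f" "delta_fun X (Suc i) g"
  shows "delta_fun X (Suc i) (\<lambda>e. h (f e) (g e))"
  using delta_fun_comp[OF assms(1) delta_fun_pair[OF assms(2,3)]] by simp

lemma delta_fun_id: "delta_fun X i (\<lambda>e. e)"
  and delta_fun_const: "delta_fun X i (\<lambda>e. c)"
  by (intro computable_imp_delta_fun computable_intros)+

lemma delta_fun_computable2:
  assumes "computable2 X h" "delta_fun X (Suc i) f" "delta_fun X (Suc i) g"
  shows "delta_fun X (Suc i) (\<lambda>e. h (f e) (g e))"
  by (intro delta_fun_comp2[OF _ assms(2,3)] computable_imp_delta_fun
     computable2_comp[OF assms(1)] computable_intros)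

lemmas delta_fun_computable = delta_fun_comp[OF computable_imp_delta_fun]

lemmas delta_fun_add = delta_fun_computable2[OF computable2_add]
lemmas delta_fun_mult = delta_fun_computable2[OF computable2_mult]
lemmas delta_fun_diff = delta_fun_computable2[OF computable2_diff]
lemmas delta_fun_Suc = delta_fun_computable[OF computable_Suc[OF computable_id]]
lemmas delta_fun_power2 = delta_fun_computable[OF computable_power2[OF computable_id]]
lemmas delta_fun_p1 = delta_fun_computable[OF computable_p1_p2(1)]
lemmas delta_fun_p2 = delta_fun_computable[OF computable_p1_p2(2)]

lemmas delta_fun_intros = delta_fun_id delta_fun_const delta_fun_add delta_fun_mult delta_fun_diff
  delta_fun_Suc delta_fun_power2 delta_fun_pair delta_fun_p1 delta_fun_p2

lemma delta_not: "delta X i P \<Longrightarrow> delta X i (\<lambda>e. \<not> P e)"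
  by (simp add: delta_def)

lemma delta_conj: "delta X i P \<Longrightarrow> delta X i Q \<Longrightarrow> delta X i (\<lambda>e. P e \<and> Q e)"
  unfolding delta_def de_Morgan_conj by (intro conjI sigma_conj sigma_disj) blast+

lemma delta_disj: "delta X i P \<Longrightarrow> delta X i Q \<Longrightarrow> delta X i (\<lambda>e. P e \<or> Q e)"
  unfolding delta_def de_Morgan_disj by (intro conjI sigma_conj sigma_disj) blast+

lemma delta_imp: "delta X i P \<Longrightarrow> delta X i Q \<Longrightarrow> delta X i (\<lambda>e. P e \<longrightarrow> Q e)"
  unfolding imp_conv_disj by (intro delta_disj delta_not)

lemma delta_eq:
  "delta_fun X (Suc i) f \<Longrightarrow> delta_fun X (Suc i) g \<Longrightarrow> delta X (Suc i) (\<lambda>e. f e = g e)"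
  using delta_subst[OF decidable_imp_delta[OF decidable_eq[OF computable_p1_p2]] delta_fun_pair[of X i f g]]
  by simp

lemma delta_less:
  "delta_fun X (Suc i) f \<Longrightarrow> delta_fun X (Suc i) g \<Longrightarrow> delta X (Suc i) (\<lambda>e. f e < g e)"
  using delta_subst[OF decidable_imp_delta[OF decidable_less[OF computable_p1_p2]] delta_fun_pair[of X i f g]]
  by simp

lemma delta_le:
  "delta_fun X (Suc i) f \<Longrightarrow> delta_fun X (Suc i) g \<Longrightarrow> delta X (Suc i) (\<lambda>e. f e \<le> g e)"
  using delta_not[OF delta_less[of X i g f]] by (simp add: not_less)

text \<open>In the rules for variable binders, the body is judged after substituting an arbitrary
  definable term for the bound variable and for the environment. This keeps all
  side conditions in the form of closure rules that apply by plain unification.\<close>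

lemma sigma_ex:
  assumes "\<And>u v. delta_fun X (Suc i) u \<Longrightarrow> delta_fun X (Suc i) v \<Longrightarrow> sigma X (Suc i) (\<lambda>e. P (u e) (v e))"
  shows "sigma X (Suc i) (\<lambda>e. \<exists>y. P y e)"
  using sigma_ex_pair[OF assms[OF computable_imp_delta_fun computable_imp_delta_fun,
      OF computable_p1_p2(2) computable_p1_p2(1)]] by simp

lemma sigma_ball:
  assumes "\<And>u v. delta_fun X (Suc i) u \<Longrightarrow> delta_fun X (Suc i) v \<Longrightarrow> sigma X (Suc i) (\<lambda>e. P (u e) (v e))"
    and "delta_fun X (Suc i) b"
  shows "sigma X (Suc i) (\<lambda>e. \<forall>y<b e. P y e)"
proof -
  have "sigma X (Suc i) (\<lambda>z. P (p1 z) (p2 z))"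
    by (intro assms(1) computable_imp_delta_fun computable_p1_p2)
  from sigma_subst_fun[OF sigma_bounded[OF this, THEN conjunct1] delta_fun_pair[OF assms(2) delta_fun_id]]
  show ?thesis by simp
qed

lemma sigma_bex:
  assumes "\<And>u v. delta_fun X (Suc i) u \<Longrightarrow> delta_fun X (Suc i) v \<Longrightarrow> sigma X (Suc i) (\<lambda>e. P (u e) (v e))"
    and "delta_fun X (Suc i) b"
  shows "sigma X (Suc i) (\<lambda>e. \<exists>y<b e. P y e)"
  by (intro sigma_ex sigma_conj assms(1) delta_sigma[OF delta_less] delta_fun_comp[OF assms(2)])

lemma delta_ball:
  assumes "\<And>u v. delta_fun X (Suc i) u \<Longrightarrow> delta_fun X (Suc i) v \<Longrightarrow> delta X (Suc i) (\<lambda>e. P (u e) (v e))"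
    and "delta_fun X (Suc i) b"
  shows "delta X (Suc i) (\<lambda>e. \<forall>y<b e. P y e)"
  unfolding delta_def not_all not_imp
  by (intro conjI sigma_ball sigma_bex assms(2) delta_sigma[OF assms(1)] delta_sigma_not[OF assms(1)])

lemma delta_bex:
  assumes "\<And>u v. delta_fun X (Suc i) u \<Longrightarrow> delta_fun X (Suc i) v \<Longrightarrow> delta X (Suc i) (\<lambda>e. P (u e) (v e))"
    and "delta_fun X (Suc i) b"
  shows "delta X (Suc i) (\<lambda>e. \<exists>y<b e. P y e)"
  using delta_not[OF delta_ball[OF delta_not[OF assms(1)] assms(2)]] by simp

lemma delta_funI:
  assumes "\<And>u v. delta_fun X (Suc i) u \<Longrightarrow> delta_fun X (Suc i) v \<Longrightarrow> sigma X (Suc i) (\<lambda>e. f (u e) = v e)"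
  shows "delta_fun X (Suc i) f"
  unfolding delta_fun_def by (intro assms computable_imp_delta_fun computable_p1_p2)

lemma delta_fun_Least:
  assumes P: "\<And>u v. delta_fun X (Suc i) u \<Longrightarrow> delta_fun X (Suc i) v \<Longrightarrow> delta X (Suc i) (\<lambda>e. P (u e) (v e))"
    and ex: "\<And>e. \<exists>m. P m e"
  shows "delta_fun X (Suc i) (\<lambda>e. LEAST m. P m e)"
proof (rule delta_funI)
  fix u v assume uv: "delta_fun X (Suc i) u" "delta_fun X (Suc i) v"
  \<comment> \<open>This turns minimality into a Delta condition with one bounded
    quantifier.\<close>
  have "((LEAST m. P m e) = y) = (P y e \<and> (\<forall>k<y. \<not> P k e))" for e y
    using LeastI_ex[OF ex[of e]] by (auto dest: not_less_Least intro!: Least_equality leI)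
  moreover have "sigma X (Suc i) (\<lambda>e. P (v e) (u e) \<and> (\<forall>k<v e. \<not> P k (u e)))"
    by (intro delta_sigma delta_conj delta_ball delta_not P uv delta_fun_comp[OF uv(1)])
  ultimately show "sigma X (Suc i) (\<lambda>e. (LEAST m. P m (u e)) = v e)" by simp
qed

lemma delta_fun_If:
  assumes "delta X (Suc i) P" "delta_fun X (Suc i) f" "delta_fun X (Suc i) g"
  shows "delta_fun X (Suc i) (\<lambda>e. if P e then f e else g e)"
proof (rule delta_funI)
  fix u v assume uv: "delta_fun X (Suc i) u" "delta_fun X (Suc i) v"
  have "((if P e then f e else g e) = y) = (P e \<and> f e = y \<or> \<not> P e \<and> g e = y)" for e y by auto
  moreover have "sigma X (Suc i) (\<lambda>e. P (u e) \<and> f (u e) = v e \<or> \<not> P (u e) \<and> g (u e) = v e)"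
    by (intro delta_sigma delta_disj delta_conj delta_not delta_eq delta_subst[OF assms(1)]
       delta_fun_comp[OF assms(2)] delta_fun_comp[OF assms(3)] uv)
  ultimately show "sigma X (Suc i) (\<lambda>e. (if P (u e) then f (u e) else g (u e)) = v e)" by simp
qed

text \<open>Search for a code of a value together with a witness that this value belongs to the
  graph. Totality of \<open>f\<close> makes the search terminate.\<close>

lemma computable_of_delta_fun:
  assumes "delta_fun X (Suc 0) f"
  shows "computable X f"
proof -
  obtain Q where Q: "sigma X 0 (\<lambda>e. \<not> Q e)" "\<And>x. f (p1 x) = p2 x \<longleftrightarrow> (\<exists>y. Q (pair x y))"
    using assms unfolding delta_fun_def by (elim sigma_SucE) blast
  let ?P = "\<lambda>z. Q (pair (pair (p2 z) (p1 (p1 z))) (p2 (p1 z)))"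
  have "decidable X Q" using decidable_not[OF Q(1)[unfolded sigma_0]] by simp
  then have P: "decidable X ?P" by (rule decidable_subst) (intro computable_intros)
  have iff: "f a = v \<longleftrightarrow> (\<exists>y. Q (pair (pair a v) y))" for a v
    using Q(2)[of "pair a v"] by simp
  have ex: "\<exists>m. ?P (pair m e)" for e
  proof -
    obtain y where "Q (pair (pair e (f e)) y)" using iff[of e "f e"] by auto
    then show ?thesis by (intro exI[of _ "pair (f e) y"]) simp
  qed
  have "f e = p1 (LEAST m. ?P (pair m e))" for e
    using LeastI_ex[OF ex[of e]] iff by auto
  then have "f = (\<lambda>e. p1 (LEAST m. ?P (pair m e)))" by blast
  moreover have "computable X (\<lambda>e. p1 (LEAST m. ?P (pair m e)))"
    by (rule computable_p1, rule computable_Least[OF P ex])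
  ultimately show ?thesis by simp
qed

lemma decidable_of_delta:
  assumes "delta X (Suc 0) P"
  shows "decidable X P"
proof -
  have "delta_fun X (Suc 0) (\<lambda>e. if P e then 1 else 0)"
    by (intro delta_fun_If assms delta_fun_const)
  from computable_of_delta_fun[OF this] show ?thesis
    by (simp add: decidable_def of_bool_def)
qed

section \<open>Oracle substitution and the limit lemma\<close>

primrec subst_query :: "rec_prog \<Rightarrow> rec_prog \<Rightarrow> rec_prog" where
  "subst_query q Zero = Zero"
| "subst_query q Succ = Succ"
| "subst_query q (Proj i) = Proj i"
| "subst_query q Query = Comp q [Proj 0]"
| "subst_query q (Comp p gs) = Comp (subst_query q p) (map (subst_query q) gs)"
| "subst_query q (Prec p r) = Prec (subst_query q p) (subst_query q r)"
| "subst_query q (Mu p) = Mu (subst_query q p)"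

text \<open>Each oracle call is replaced by the program \<open>q\<close>, which decides
  \<open>X\<close> from \<open>Y\<close>; \<open>Proj 0\<close> discards the further arguments that
  \<open>Query\<close> ignores.\<close>

lemma evals_subst_query:
  assumes "\<And>x. evals Y q [x] (of_bool (x \<in> X))" "evals X p xs y"
  shows "evals Y (subst_query q p) xs y"
  using assms(2)
proof (induction rule: evals.induct)
  case (4 x xs)
  show ?case unfolding subst_query.simps by (rule evals_Comp1[OF evals_Proj0 assms(1)])
next
  case (5 xs gs ys p z)
  have "list_all2 (\<lambda>g y. evals Y g xs y) (map (subst_query q) gs) ys"
    using "5.IH"(1) by (auto simp: list_all2_map1 elim!: list_all2_mono)
  with "5.IH"(2) show ?case by (auto intro: evals.intros)
next
  case (8 p m xs)
  then show ?case by (auto intro!: evals.intros(8))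
qed (auto intro: evals.intros)

lemma sigma_mono:
  assumes "X \<le>\<^sub>T Y"
  shows "sigma X i P \<Longrightarrow> sigma Y i P"
proof (induction i arbitrary: P)
  case 0
  then show ?case using assms
    unfolding sigma_def Sigma0.simps turing_le_def by (blast intro: evals_subst_query)
next
  case (Suc i)
  then show ?case unfolding sigma_Suc by blast
qed

lemma delta_mono: "X \<le>\<^sub>T Y \<Longrightarrow> delta X i P \<Longrightarrow> delta Y i P"
  unfolding delta_def by (blast intro: sigma_mono)

lemma empty_turing_le: "{} \<le>\<^sub>T X"
  unfolding turing_le_def by (auto intro: evals.intros)

text \<open>A code \<open>w\<close> guesses a value of \<open>F a\<close> with a witness, and
  correctness \<open>G a w\<close> is a universal statement \<open>\<forall>u. C w a u\<close>. At
  time \<open>u\<close> the least guess not yet refuted is followed. The least correct guess is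
  never refuted, and the finitely many smaller ones are refuted eventually.\<close>

lemma limit_lemma:
  assumes "delta_fun X (Suc (Suc i)) F"
  shows "\<exists>L. delta_fun X (Suc i) L \<and> (\<forall>a. \<exists>N. \<forall>u\<ge>N. L (pair a u) = F a)"
proof -
  obtain Q where Q: "sigma X (Suc i) (\<lambda>e. \<not> Q e)" "\<And>x. F (p1 x) = p2 x \<longleftrightarrow> (\<exists>y. Q (pair x y))"
    using sigma_SucE[OF assms[unfolded delta_fun_def]] by blast
  obtain R where R: "sigma X i (\<lambda>e. \<not> R e)" "\<And>x. \<not> Q x \<longleftrightarrow> (\<exists>t. R (pair x t))"
    using sigma_SucE[OF Q(1)] by blast
  define C where "C w a u \<longleftrightarrow> (\<forall>t<u. \<not> R (pair (pair (pair a (p1 w)) (p2 w)) t))" for w a u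
  define L where "L z = p1 (LEAST w. C w (p1 z) (p2 z))" for z
  define G where "G a w \<longleftrightarrow> Q (pair (pair a (p1 w)) (p2 w))" for a w
  have F: "p1 w = F a" if "G a w" for a w
    using that Q(2)[of "pair a (p1 w)"] by (auto simp: G_def)
  have GC: "G a w \<longleftrightarrow> (\<forall>u. C w a u)" for a w
    using R(2)[of "pair (pair a (p1 w)) (p2 w)"] by (auto simp: G_def C_def)
  have ex: "\<exists>w. G a w" for a
  proof -
    obtain y where "Q (pair (pair a (F a)) y)" using Q(2)[of "pair a (F a)"] by auto
    then show ?thesis by (intro exI[of _ "pair (F a) y"]) (simp add: G_def)
  qed
  have "delta X (Suc i) (\<lambda>e. \<not> R e)" by (rule sigma_imp_delta_Suc[OF R(1)])
  note nR = delta_subst[OF this]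
  have "delta_fun X (Suc i) L"
    unfolding L_def
  proof (rule delta_fun_p1, rule delta_fun_Least)
    show "\<exists>m. C m (p1 e) (p2 e)" for e using ex GC by blast
    fix u v assume "delta_fun X (Suc i) u" "delta_fun X (Suc i) v"
    then show "delta X (Suc i) (\<lambda>e. C (u e) (p1 (v e)) (p2 (v e)))"
      unfolding C_def by - (rule delta_ball nR delta_fun_intros | assumption | rule delta_fun_comp, assumption)+
  qed
  moreover have "\<exists>N. \<forall>u\<ge>N. L (pair a u) = F a" for a
  proof -
    define w0 where "w0 = (LEAST w. G a w)"
    have w0: "G a w0" unfolding w0_def by (rule LeastI_ex[OF ex])
    have "\<forall>w<w0. \<exists>u. \<not> C w a u"
      using not_less_Least[of _ "G a"] by (auto simp: w0_def GC)
    then obtain g where g: "\<And>w. w < w0 \<Longrightarrow> \<not> C w a (g w)" by metis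
    \<comment> \<open>A time by which all smaller guesses are refuted; the inserted 0 covers the
      case \<open>w0 = 0\<close>.\<close>
    define N where "N = Max (insert 0 (g ` {..<w0}))"
    have "L (pair a u) = F a" if "u \<ge> N" for u
    proof -
      have "(LEAST w. C w a u) = w0"
      proof (rule Least_equality)
        show "C w0 a u" using w0 GC by blast
        fix w assume w: "C w a u"
        show "w0 \<le> w"
        proof (rule ccontr)
          assume "\<not> w0 \<le> w"
          then have "w < w0" by simp
          then have "g w \<le> u" using that by (auto simp: N_def)
          then show False using g[OF \<open>w < w0\<close>] w by (auto simp: C_def)
        qed
      qed
      then show ?thesis using F[OF w0] by (simp add: L_def)
    qed
    then show ?thesis by blast
  qed
  ultimately show ?thesis by blast
qed

subsection \<open>Derivation systems and recursion\<close>

text \<open>Inductive relations are brought into this format so that one lemma,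
  \<open>sigma_derivable\<close>, bounds their complexity. A rule with a single premise ignores
  \<open>J2\<close>.\<close>

inductive derivable :: "(nat \<Rightarrow> bool) \<Rightarrow> (nat \<Rightarrow> nat \<Rightarrow> nat \<Rightarrow> bool) \<Rightarrow> nat \<Rightarrow> bool"
  for A :: "nat \<Rightarrow> bool" and R :: "nat \<Rightarrow> nat \<Rightarrow> nat \<Rightarrow> bool" where
  "A J \<Longrightarrow> derivable A R J"
| "derivable A R J1 \<Longrightarrow> derivable A R J2 \<Longrightarrow> R J1 J2 J \<Longrightarrow> derivable A R J"

text \<open>A derivation is a finite set of judgements, each tagged with a rank that
  exceeds the ranks of the premises used.\<close>

definition derivation :: "(nat \<Rightarrow> bool) \<Rightarrow> (nat \<Rightarrow> nat \<Rightarrow> nat \<Rightarrow> bool) \<Rightarrow> nat set \<Rightarrow> bool" where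
  "derivation A R S \<longleftrightarrow> (\<forall>p\<in>S. A (p2 p) \<or>
     (\<exists>q\<in>S. \<exists>q'\<in>S. p1 q < p1 p \<and> p1 q' < p1 p \<and> R (p2 q) (p2 q') (p2 p)))"

lemma derivation_sound:
  assumes "derivation A R S"
  shows "p \<in> S \<Longrightarrow> derivable A R (p2 p)"
proof (induction "p1 p" arbitrary: p rule: less_induct)
  case less
  then show ?case using assms unfolding derivation_def by (metis derivable.intros)
qed

lemma derivation_complete:
  "derivable A R J \<Longrightarrow> \<exists>S t. finite S \<and> derivation A R S \<and> pair t J \<in> S"
proof (induction rule: derivable.induct)
  case (1 J)
  then show ?case by (intro exI[of _ "{pair 0 J}"]) (auto simp: derivation_def)
next
  case (2 J1 J2 J)
  then obtain S1 S2 t1 t2 where S: "finite S1" "derivation A R S1" "pair t1 J1 \<in> S1"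
    "finite S2" "derivation A R S2" "pair t2 J2 \<in> S2" by blast
  let ?p = "pair (Suc (t1 + t2)) J"
  let ?S = "insert ?p (S1 \<union> S2)"
  have "\<exists>q\<in>?S. \<exists>q'\<in>?S. p1 q < p1 ?p \<and> p1 q' < p1 ?p \<and> R (p2 q) (p2 q') (p2 ?p)"
    using S(3,6) 2(3) by (intro bexI[of _ "pair t1 J1"] bexI[of _ "pair t2 J2"]) auto
  moreover have "A (p2 p) \<or>
     (\<exists>q\<in>?S. \<exists>q'\<in>?S. p1 q < p1 p \<and> p1 q' < p1 p \<and> R (p2 q) (p2 q') (p2 p))" if "p \<in> S1 \<union> S2" for p
    using S(2,5) that unfolding derivation_def by blast
  ultimately have "derivation A R ?S" unfolding derivation_def by blast
  with S show ?case by (intro exI[of _ ?S] exI[of _ "Suc (t1 + t2)"]) simp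
qed

lemma derivable_iff:
  "derivable A R J \<longleftrightarrow> (\<exists>d. (\<exists>t. pair t J \<in> set_decode d) \<and> derivation A R (set_decode d))"
proof
  assume "derivable A R J"
  then obtain S t where "finite S" "derivation A R S" "pair t J \<in> S"
    using derivation_complete by blast
  then show "\<exists>d. (\<exists>t. pair t J \<in> set_decode d) \<and> derivation A R (set_decode d)"
    by (intro exI[of _ "set_encode S"]) auto
qed (metis derivation_sound p2_pair)

text \<open>Lets quantifiers over the elements of a coded finite set be bounded by its code.\<close>

lemma set_decode_bound: "x \<in> set_decode d \<Longrightarrow> x < d"
proof -
  assume "x \<in> set_decode d"
  then have "2 ^ x \<le> d" unfolding set_decode_def by (auto intro: ccontr)
  then show "x < d" using less_exp[of x] by (rule order.strict_trans2[rotated])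
qed

text \<open>Rewrites a set bit of the binary expansion by arithmetic terms under bounded
  quantifiers, the form in which the Delta closure rules apply.\<close>

lemma set_decode_iff: "x \<in> set_decode d \<longleftrightarrow> (\<exists>q<Suc d. \<exists>r<2 ^ x. d = (2 * q + 1) * 2 ^ x + r)"
proof
  assume "x \<in> set_decode d"
  then have "odd (d div 2 ^ x)" by (simp add: set_decode_def)
  then obtain q where q: "d div 2 ^ x = 2 * q + 1" by (rule oddE)
  then have "q < Suc d" using div_le_dividend[of d "2 ^ x"] by linarith
  moreover have "d = (2 * q + 1) * 2 ^ x + d mod 2 ^ x" by (metis q div_mult_mod_eq)
  moreover have "d mod 2 ^ x < 2 ^ x" by simp
  ultimately show "\<exists>q<Suc d. \<exists>r<2 ^ x. d = (2 * q + 1) * 2 ^ x + r" by blast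
next
  assume "\<exists>q<Suc d. \<exists>r<2 ^ x. d = (2 * q + 1) * 2 ^ x + r"
  then obtain q r where "r < 2 ^ x" "d = (2 * q + 1) * 2 ^ x + r" by blast
  then have "d div 2 ^ x = 2 * q + 1" by (intro div_nat_eqI) (auto simp: algebra_simps)
  then show "x \<in> set_decode d" by (simp add: set_decode_def)
qed

lemma delta_mem_set_decode:
  assumes "delta_fun X (Suc i) f" "delta_fun X (Suc i) g"
  shows "delta X (Suc i) (\<lambda>e. f e \<in> set_decode (g e))"
  unfolding set_decode_iff
  by (rule delta_bex delta_eq delta_fun_intros delta_fun_comp[OF assms(1)]
    delta_fun_comp[OF assms(2)] assms | assumption | rule delta_fun_comp, assumption)+

text \<open>A derivation is guessed by an unbounded existential quantifier over its code
  \<open>d\<close>; checking its local correctness involves only quantifiers bounded by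
  \<open>d\<close>.\<close>

lemma sigma_derivable:
  assumes A: "\<And>u. delta_fun X (Suc i) u \<Longrightarrow> sigma X (Suc i) (\<lambda>e. A (u e))"
    and R: "\<And>u v w. delta_fun X (Suc i) u \<Longrightarrow> delta_fun X (Suc i) v \<Longrightarrow> delta_fun X (Suc i) w
      \<Longrightarrow> sigma X (Suc i) (\<lambda>e. R (u e) (v e) (w e))"
    and f: "delta_fun X (Suc i) f"
  shows "sigma X (Suc i) (\<lambda>e. derivable A R (f e))"
proof -
  have bounded: "(\<forall>p\<in>set_decode d. P p) \<longleftrightarrow> (\<forall>p<d. p \<notin> set_decode d \<or> P p)"
    "(\<exists>p\<in>set_decode d. P p) \<longleftrightarrow> (\<exists>p<d. p \<in> set_decode d \<and> P p)" for d P
    by (blast dest: set_decode_bound)+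
  show ?thesis
    unfolding derivable_iff derivation_def bounded
    by (rule sigma_ex sigma_ball sigma_bex sigma_conj sigma_disj A R
      delta_sigma[OF delta_mem_set_decode] delta_sigma_not[OF delta_mem_set_decode]
      delta_sigma[OF delta_less] delta_fun_intros delta_fun_comp[OF f] f | assumption | rule delta_fun_comp, assumption)+
qed

lemma delta_fun_rec:
  assumes a: "\<And>u. delta_fun X (Suc i) u \<Longrightarrow> delta_fun X (Suc i) (\<lambda>e. a (u e))"
    and h: "\<And>u v w. delta_fun X (Suc i) u \<Longrightarrow> delta_fun X (Suc i) v \<Longrightarrow> delta_fun X (Suc i) w
      \<Longrightarrow> delta_fun X (Suc i) (\<lambda>e. h (u e) (v e) (w e))"
    and s: "\<And>x. s x 0 = a x" "\<And>x n. s x (Suc n) = h x n (s x n)"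
    and f: "delta_fun X (Suc i) f" and g: "delta_fun X (Suc i) g"
  shows "delta_fun X (Suc i) (\<lambda>e. s (f e) (g e))"
proof (rule delta_funI)
  \<comment> \<open>A judgement \<open>pair x (pair n v)\<close> asserts \<open>s x n = v\<close>,
    so the derivable judgements form the graph of \<open>s\<close>.\<close>
  define A where "A J \<longleftrightarrow> p1 (p2 J) = 0 \<and> p2 (p2 J) = a (p1 J)" for J
  define R where "R J1 J2 J \<longleftrightarrow> p1 J = p1 J1 \<and> p1 (p2 J) = Suc (p1 (p2 J1)) \<and>
    p2 (p2 J) = h (p1 J1) (p1 (p2 J1)) (p2 (p2 J1))" for J1 J2 J :: nat
  have sound: "derivable A R J \<Longrightarrow> p2 (p2 J) = s (p1 J) (p1 (p2 J))" for J
    by (induction rule: derivable.induct) (auto simp: A_def R_def s)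
  have complete: "derivable A R (pair x (pair n (s x n)))" for x n
  proof (induction n)
    case 0
    then show ?case by (intro derivable.intros(1)) (simp add: A_def s)
  next
    case (Suc n)
    show ?case by (rule derivable.intros(2)[OF Suc Suc]) (simp add: R_def s)
  qed
  have iff: "s x n = v \<longleftrightarrow> derivable A R (pair x (pair n v))" for x n v
    using sound[of "pair x (pair n v)"] complete[of x n] by auto
  fix u v assume uv: "delta_fun X (Suc i) u" "delta_fun X (Suc i) v"
  show "sigma X (Suc i) (\<lambda>e. s (f (u e)) (g (u e)) = v e)"
    unfolding iff
    by (rule sigma_derivable, unfold A_def R_def)
      (rule sigma_conj delta_sigma[OF delta_eq] a h delta_fun_intros delta_fun_comp[OF f]
        delta_fun_comp[OF g] uv | assumption | rule delta_fun_comp, assumption)+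
qed

subsection \<open>Universal relations\<close>

fun code :: "rec_prog \<Rightarrow> nat" where
  "code Zero = pair 0 0"
| "code Succ = pair 1 0"
| "code (Proj i) = pair 2 i"
| "code Query = pair 3 0"
| "code (Comp p gs) = pair 4 (pair (code p) (list_encode (map code gs)))"
| "code (Prec p q) = pair 5 (pair (code p) (code q))"
| "code (Mu p) = pair 6 (code p)"

text \<open>Judgements by tag: 0 is evaluation of a program, 1 is evaluation of a list of programs,
  2 is list lookup, and 3 says that a program has positive values at all arguments below a bound.
  The split brings every evaluation rule into a form with at most two premises.\<close>

abbreviation judgement :: "nat \<Rightarrow> nat \<Rightarrow> nat \<Rightarrow> nat \<Rightarrow> nat" where
  "judgement t a b c \<equiv> pair t (pair a (pair b c))"

text \<open>The recursive clause of \<open>list_encode\<close>, so that rules on argument lists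
  become equations between numbers.\<close>

abbreviation cons_code :: "nat \<Rightarrow> nat \<Rightarrow> nat" where
  "cons_code x l \<equiv> Suc (pair x l)"

text \<open>The oracle is empty here, so every \<open>Query\<close> gets the answer 0.\<close>

definition eval_axiom :: "nat \<Rightarrow> bool" where
  "eval_axiom J \<longleftrightarrow>
     (\<exists>l. J = judgement 0 (pair 0 0) l 0) \<or>
     (\<exists>x l. J = judgement 0 (pair 1 0) (cons_code x l) (Suc x)) \<or>
     (\<exists>x l. J = judgement 0 (pair 3 0) (cons_code x l) 0) \<or>
     (\<exists>l. J = judgement 1 0 l 0) \<or>
     (\<exists>x l. J = judgement 2 0 (cons_code x l) x) \<or>
     (\<exists>p l. J = judgement 3 p l 0)"

definition eval_rule :: "nat \<Rightarrow> nat \<Rightarrow> nat \<Rightarrow> bool" where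
  "eval_rule J1 J2 J \<longleftrightarrow>
     (\<exists>i l y. J1 = judgement 2 i l y \<and> J = judgement 0 (pair 2 i) l y) \<or>
     (\<exists>i x l y. J1 = judgement 2 i l y \<and> J = judgement 2 (Suc i) (cons_code x l) y) \<or>
     (\<exists>g gs l y ys. J1 = judgement 0 g l y \<and> J2 = judgement 1 gs l ys \<and>
        J = judgement 1 (cons_code g gs) l (cons_code y ys)) \<or>
     (\<exists>p gs l ys z. J1 = judgement 1 gs l ys \<and> J2 = judgement 0 p ys z \<and>
        J = judgement 0 (pair 4 (pair p gs)) l z) \<or>
     (\<exists>p q l y. J1 = judgement 0 p l y \<and> J = judgement 0 (pair 5 (pair p q)) (cons_code 0 l) y) \<or>
     (\<exists>p q m l r y. J1 = judgement 0 (pair 5 (pair p q)) (cons_code m l) r \<and>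
        J2 = judgement 0 q (cons_code m (cons_code r l)) y \<and>
        J = judgement 0 (pair 5 (pair p q)) (cons_code (Suc m) l) y) \<or>
     (\<exists>p l m y. J1 = judgement 3 p l m \<and> J2 = judgement 0 p (cons_code m l) (Suc y) \<and>
        J = judgement 3 p l (Suc m)) \<or>
     (\<exists>p l m. J1 = judgement 3 p l m \<and> J2 = judgement 0 p (cons_code m l) 0 \<and>
        J = judgement 0 (pair 6 p) l m)"

lemma code_eq_iff:
  "code p = pair 0 0 \<longleftrightarrow> p = Zero"
  "code p = pair 1 0 \<longleftrightarrow> p = Succ"
  "code p = pair 2 i \<longleftrightarrow> p = Proj i"
  "code p = pair 3 0 \<longleftrightarrow> p = Query"
  "code p = pair 4 (pair a b) \<longleftrightarrow> (\<exists>q gs. p = Comp q gs \<and> a = code q \<and> b = list_encode (map code gs))"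
  "code p = pair 5 (pair a b) \<longleftrightarrow> (\<exists>q r. p = Prec q r \<and> a = code q \<and> b = code r)"
  "code p = pair 6 a \<longleftrightarrow> (\<exists>q. p = Mu q \<and> a = code q)"
  by (cases p; auto)+

lemma list_encode_eq_iff:
  "list_encode xs = 0 \<longleftrightarrow> xs = []"
  "list_encode xs = cons_code x l \<longleftrightarrow> (\<exists>xs'. xs = x # xs' \<and> l = list_encode xs')"
  by (cases xs; auto)+

text \<open>The soundness invariant of the rules. A judgement whose program component codes no
  program satisfies it vacuously.\<close>

definition valid :: "nat \<Rightarrow> bool" where
  "valid J \<longleftrightarrow>
     (\<forall>p xs y. J = judgement 0 (code p) (list_encode xs) y \<longrightarrow> evals {} p xs y) \<and>
     (\<forall>gs xs ys. J = judgement 1 (list_encode (map code gs)) (list_encode xs) (list_encode ys) \<longrightarrow>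
        list_all2 (\<lambda>g y. evals {} g xs y) gs ys) \<and>
     (\<forall>i xs y. J = judgement 2 i (list_encode xs) y \<longrightarrow> i < length xs \<and> xs ! i = y) \<and>
     (\<forall>p xs m. J = judgement 3 (code p) (list_encode xs) m \<longrightarrow>
        (\<forall>k<m. \<exists>y. evals {} p (k # xs) (Suc y)))"

lemma valid_simps:
  "valid (judgement 0 a l y) \<longleftrightarrow> (\<forall>p xs. code p = a \<longrightarrow> list_encode xs = l \<longrightarrow> evals {} p xs y)"
  "valid (judgement (Suc 0) a l b) \<longleftrightarrow> (\<forall>gs xs ys. list_encode (map code gs) = a \<longrightarrow> list_encode xs = l \<longrightarrow>
     list_encode ys = b \<longrightarrow> list_all2 (\<lambda>g y. evals {} g xs y) gs ys)"
  "valid (judgement 2 i l y) \<longleftrightarrow> (\<forall>xs. list_encode xs = l \<longrightarrow> i < length xs \<and> xs ! i = y)"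
  "valid (judgement 3 a l m) \<longleftrightarrow> (\<forall>p xs. code p = a \<longrightarrow> list_encode xs = l \<longrightarrow>
        (\<forall>k<m. \<exists>y. evals {} p (k # xs) (Suc y)))"
  by (auto simp: valid_def)

lemma list_encode_surj: "\<exists>xs. list_encode xs = l"
  by (metis list_decode_inverse)

lemma valid_axiom: "eval_axiom J \<Longrightarrow> valid J"
  unfolding eval_axiom_def
  by (auto simp: valid_simps code_eq_iff[simplified] list_encode_eq_iff
      intro: evals.intros evals.intros(4)[where X = "{}", simplified])

lemma valid_rule:
  assumes "valid J1" "valid J2" "eval_rule J1 J2 J"
  shows "valid J"
  using assms(3) unfolding eval_rule_def
proof (elim disjE exE conjE)
  fix i l y assume "J1 = judgement 2 i l y" "J = judgement 0 (pair 2 i) l y"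
  then show ?thesis using assms(1)
    by (auto simp: valid_simps code_eq_iff intro: evals_Proj)
next
  fix i x l y assume "J1 = judgement 2 i l y" "J = judgement 2 (Suc i) (cons_code x l) y"
  then show ?thesis using assms(1)
    by (auto simp: valid_simps list_encode_eq_iff)
next
  fix g gs l y ys
  assume "J1 = judgement 0 g l y" "J2 = judgement 1 gs l ys"
    "J = judgement 1 (cons_code g gs) l (cons_code y ys)"
  then show ?thesis using assms(1,2)
    by (auto simp: valid_simps list_encode_eq_iff map_eq_Cons_conv)
next
  fix p gs l ys z
  assume *: "J1 = judgement 1 gs l ys" "J2 = judgement 0 p ys z" "J = judgement 0 (pair 4 (pair p gs)) l z"
  \<comment> \<open>The intermediate values are given only as a number, which codes some
    list.\<close>
  obtain Ys where "list_encode Ys = ys" using list_encode_surj by blast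
  then show ?thesis using assms(1,2) *
    by (auto simp: valid_simps code_eq_iff intro!: evals.intros(5)[of _ _ _ Ys])
next
  fix p q l y
  assume "J1 = judgement 0 p l y" "J = judgement 0 (pair 5 (pair p q)) (cons_code 0 l) y"
  then show ?thesis using assms(1)
    by (auto simp: valid_simps code_eq_iff list_encode_eq_iff intro: evals.intros)
next
  fix p q m l r y
  assume *: "J1 = judgement 0 (pair 5 (pair p q)) (cons_code m l) r"
    "J2 = judgement 0 q (cons_code m (cons_code r l)) y"
    "J = judgement 0 (pair 5 (pair p q)) (cons_code (Suc m) l) y"
  have "evals {} P xs y" if P: "code P = pair 5 (pair p q)" and xs: "list_encode xs = cons_code (Suc m) l" for P xs
  proof -
    obtain p' q' where P': "P = Prec p' q'" "p = code p'" "q = code q'"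
      using P by (auto simp: code_eq_iff)
    obtain xs' where xs': "xs = Suc m # xs'" "l = list_encode xs'"
      using xs by (auto simp: list_encode_eq_iff)
    have "evals {} P (m # xs') r" using assms(1) xs' P unfolding *(1) valid_simps by simp
    moreover have "evals {} q' (m # r # xs') y" using assms(2) xs' P' unfolding *(2) valid_simps by simp
    ultimately show ?thesis unfolding P' xs' by (rule evals.intros)
  qed
  then show ?thesis unfolding *(3) valid_simps by blast
next
  fix p l m y
  assume "J1 = judgement 3 p l m" "J2 = judgement 0 p (cons_code m l) (Suc y)" "J = judgement 3 p l (Suc m)"
  then show ?thesis using assms(1,2)
    by (auto simp: valid_simps list_encode_eq_iff less_Suc_eq) blast
next
  fix p l m
  assume "J1 = judgement 3 p l m" "J2 = judgement 0 p (cons_code m l) 0" "J = judgement 0 (pair 6 p) l m"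
  then show ?thesis using assms(1,2)
    by (auto simp: valid_simps code_eq_iff list_encode_eq_iff intro!: evals.intros(8))
qed

abbreviation "eval_derivable \<equiv> derivable eval_axiom eval_rule"

lemma eval_derivable_lookup:
  "i < length xs \<Longrightarrow> eval_derivable (judgement 2 i (list_encode xs) (xs ! i))"
proof (induction xs arbitrary: i)
  case (Cons x xs)
  show ?case
  proof (cases i)
    case 0
    then show ?thesis by (intro derivable.intros(1)) (simp add: eval_axiom_def)
  next
    case (Suc j)
    then have "eval_derivable (judgement 2 j (list_encode xs) (xs ! j))" using Cons by simp
    then show ?thesis 
      by (rule derivable.intros(2)) (use Suc in \<open>auto simp: eval_rule_def intro: \<open>eval_derivable _\<close>\<close>)
  qed
qed simp

lemma eval_derivable_list:
  "list_all2 (\<lambda>g y. eval_derivable (judgement 0 (code g) (list_encode xs) y)) gs ys \<Longrightarrow>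
   eval_derivable (judgement 1 (list_encode (map code gs)) (list_encode xs) (list_encode ys))"
proof (induction rule: list_all2_induct)
  case Nil
  then show ?case by (intro derivable.intros(1)) (simp add: eval_axiom_def)
next
  case (Cons g gs y ys)
  then show ?case by (intro derivable.intros(2)[OF Cons(1,3)]) (simp add: eval_rule_def)
qed

lemma eval_derivable_positive:
  "(\<And>k. k < m \<Longrightarrow> \<exists>y. eval_derivable (judgement 0 p (cons_code k l) (Suc y))) \<Longrightarrow>
   eval_derivable (judgement 3 p l m)"
proof (induction m)
  case 0
  then show ?case by (intro derivable.intros(1)) (simp add: eval_axiom_def)
next
  case (Suc m)
  then obtain y where y: "eval_derivable (judgement 0 p (cons_code m l) (Suc y))" by blast
  show ?case
    by (rule derivable.intros(2)[OF Suc.IH y]) (use Suc.prems in \<open>auto simp: eval_rule_def\<close>)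
qed

lemma eval_derivable_complete:
  "evals {} p xs y \<Longrightarrow> eval_derivable (judgement 0 (code p) (list_encode xs) y)"
proof (induction rule: evals.induct)
  case (1 xs)
  then show ?case by (intro derivable.intros(1)) (simp add: eval_axiom_def)
next
  case (2 x xs)
  then show ?case by (intro derivable.intros(1)) (simp add: eval_axiom_def)
next
  case (3 i xs)
  from eval_derivable_lookup[OF this] show ?case
    by (rule derivable.intros(2)[OF _ eval_derivable_lookup[OF 3]]) (simp add: eval_rule_def)
next
  case (4 x xs)
  then show ?case by (intro derivable.intros(1)) (simp add: eval_axiom_def)
next
  case (5 xs gs ys p z)
  have "list_all2 (\<lambda>g y. eval_derivable (judgement 0 (code g) (list_encode xs) y)) gs ys"
    using 5(1) by (rule list_all2_mono) simp
  from derivable.intros(2)[OF eval_derivable_list[OF this] "5.IH"(2)] show ?case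
    by (simp add: eval_rule_def)
next
  case (6 p xs y q)
  show ?case by (rule derivable.intros(2)[OF 6(2) 6(2)]) (simp add: eval_rule_def)
next
  case (7 p q m xs r y)
  show ?case by (rule derivable.intros(2)[OF 7(3,4)]) (simp add: eval_rule_def)
next
  case (8 p m xs)
  have "eval_derivable (judgement 3 (code p) (list_encode xs) m)"
    using 8(3) by (intro eval_derivable_positive) auto
  from derivable.intros(2)[OF this 8(2)] show ?case by (simp add: eval_rule_def)
qed

lemma eval_derivable_iff:
  "eval_derivable (judgement 0 (code p) (list_encode xs) y) \<longleftrightarrow> evals {} p xs y"
proof
  have "eval_derivable J \<Longrightarrow> valid J" for J
    by (induction rule: derivable.induct) (blast intro: valid_axiom valid_rule)+
  then show "eval_derivable (judgement 0 (code p) (list_encode xs) y) \<Longrightarrow> evals {} p xs y"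
    using valid_simps by blast
qed (rule eval_derivable_complete)

lemma sigma_eval_derivable:
  assumes "delta_fun X (Suc i) f"
  shows "sigma X (Suc i) (\<lambda>e. eval_derivable (f e))"
  by (rule sigma_derivable, unfold eval_axiom_def eval_rule_def)
    (rule sigma_ex sigma_conj sigma_disj delta_sigma[OF delta_eq] delta_fun_intros
      assms | assumption | rule delta_fun_comp, assumption)+

fun universal :: "nat \<Rightarrow> nat \<Rightarrow> nat \<Rightarrow> bool" where
  "universal 0 e x \<longleftrightarrow> (\<exists>y. eval_derivable (judgement 0 e (cons_code (pair x y) 0) 0))"
| "universal (Suc i) e x \<longleftrightarrow> (\<exists>y. \<not> universal i e (pair x y))"

text \<open>The relation \<open>universal i\<close> enumerates the classes of level \<open>i + 1\<close>.\<close>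

lemma sigma_universal: "sigma {} (Suc i) (\<lambda>z. universal i (p1 z) (p2 z))"
proof (induction i)
  case 0
  show ?case unfolding universal.simps
    by (rule sigma_ex sigma_eval_derivable delta_fun_intros | assumption | rule delta_fun_comp, assumption)+
next
  case (Suc i)
  have "sigma {} (Suc i) (\<lambda>w. universal i (p1 (p1 w)) (pair (p2 (p1 w)) (p2 w)))"
    using sigma_subst[OF Suc, of "\<lambda>w. pair (p1 (p1 w)) (pair (p2 (p1 w)) (p2 w))"]
    by (simp add: computable_intros)
  then have "sigma {} (Suc i) (\<lambda>w. \<not> \<not> universal i (p1 (p1 w)) (pair (p2 (p1 w)) (p2 w)))" by simp
  from sigma_SucI[OF this] show ?case by simp
qed

text \<open>At the base the index is the code of a program deciding the complement of the matrix, so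
  value 0 means that the matrix holds. At a successor the index of the complement of the matrix, one
  level below, is reused.\<close>

lemma universal_complete: "sigma {} (Suc i) P \<Longrightarrow> \<exists>e. \<forall>x. P x \<longleftrightarrow> universal i e x"
proof (induction i arbitrary: P)
  case 0
  then obtain Q where Q: "sigma {} 0 (\<lambda>e. \<not> Q e)" "\<And>x. P x \<longleftrightarrow> (\<exists>y. Q (pair x y))"
    using sigma_SucE by blast
  obtain p where p: "\<And>x. evals {} p [x] (of_bool (\<not> Q x))"
    using Q(1) by (auto simp: sigma_def turing_le_def)
  have "Q x \<longleftrightarrow> evals {} p [x] 0" for x
    using evals_functional[OF p[of x]] p[of x] by (cases "Q x") auto
  then have "P x \<longleftrightarrow> universal 0 (code p) x" for x
    unfolding Q(2) using eval_derivable_iff[of p "[pair x _]" 0] by simp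
  then show ?case by blast
next
  case (Suc i)
  then obtain Q where Q: "sigma {} (Suc i) (\<lambda>e. \<not> Q e)" "\<And>x. P x \<longleftrightarrow> (\<exists>y. Q (pair x y))"
    using sigma_SucE[OF Suc.prems] by blast
  obtain e where "\<And>x. \<not> Q x \<longleftrightarrow> universal i e x" using Suc.IH[OF Q(1)] by blast
  then have "\<forall>x. P x \<longleftrightarrow> universal (Suc i) e x" unfolding Q(2) by auto
  then show ?case by blast
qed

subsection \<open>The finite injury construction\<close>

text \<open>Splits off the outermost quantifier. The matrix \<open>V\<close> is the complement of a
  Sigma predicate of level \<open>i\<close>, hence Delta of level \<open>i + 1\<close>, so the
  stages of the construction can consult it.\<close>

lemma universal_witness:
  obtains V where
    "\<And>u v w. delta_fun {} (Suc i) u \<Longrightarrow> delta_fun {} (Suc i) v \<Longrightarrow> delta_fun {} (Suc i) w \<Longrightarrow>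
       delta {} (Suc i) (\<lambda>z. V (u z) (v z) (w z))"
    "\<And>e x. universal i e x \<longleftrightarrow> (\<exists>s. V e x s)"
proof -
  obtain Q where Q: "sigma {} i (\<lambda>e. \<not> Q e)"
    "\<And>z. universal i (p1 z) (p2 z) \<longleftrightarrow> (\<exists>y. Q (pair z y))"
    using sigma_SucE[OF sigma_universal[of i]] by blast
  have "delta {} (Suc i) (\<lambda>e. \<not> \<not> Q e)"
    by (rule delta_not[OF sigma_imp_delta_Suc[OF Q(1)]])
  then have "delta {} (Suc i) Q" by simp
  then have "delta {} (Suc i) (\<lambda>z. Q (pair (pair (u z) (v z)) (w z)))"
    if "delta_fun {} (Suc i) u" "delta_fun {} (Suc i) v" "delta_fun {} (Suc i) w" for u v w
    by (rule delta_subst) (intro delta_fun_pair that)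
  moreover have "universal i e x \<longleftrightarrow> (\<exists>s. Q (pair (pair e x) s))" for e x
    using Q(2)[of "pair e x"] by simp
  ultimately show ?thesis by (rule that)
qed

text \<open>Requirement \<open>r\<close> asks that the set of color \<open>p1 r\<close> differs from the set enumerated with
  index \<open>p2 r\<close>. Its witness is \<open>mark x r\<close> in the approximation at stage \<open>x\<close>, and
  \<open>final_mark r\<close> in the limit. A requirement that acts at stage \<open>s\<close> moves all later
  witnesses beyond \<open>s\<close>.\<close>

locale diagonalization =
  fixes i :: nat and V :: "nat \<Rightarrow> nat \<Rightarrow> nat \<Rightarrow> bool"
  assumes delta_V: "delta_fun {} (Suc i) u \<Longrightarrow> delta_fun {} (Suc i) v \<Longrightarrow> delta_fun {} (Suc i) w \<Longrightarrow>
       delta {} (Suc i) (\<lambda>z. V (u z) (v z) (w z))"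
    and universal_iff: "universal i e x \<longleftrightarrow> (\<exists>s. V e x s)"
begin

text \<open>A search capped at \<open>x\<close>, hence total; the result is below \<open>x\<close>
  exactly when a witness occurs below \<open>x\<close>.\<close>

definition stage :: "nat \<Rightarrow> nat \<Rightarrow> nat \<Rightarrow> nat" where
  "stage e k x = (LEAST s. V e k s \<or> s = x)"

definition next_mark :: "nat \<Rightarrow> nat \<Rightarrow> nat \<Rightarrow> nat" where
  "next_mark x r k = Suc (k + (if stage (p2 r) k x < x then stage (p2 r) k x else 0))"

primrec mark :: "nat \<Rightarrow> nat \<Rightarrow> nat" where
  "mark x 0 = 0"
| "mark x (Suc r) = next_mark x r (mark x r)"

primrec final_mark :: "nat \<Rightarrow> nat" where
  "final_mark 0 = 0"
| "final_mark (Suc r) = Suc (final_mark r +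
     (if \<exists>s. V (p2 r) (final_mark r) s then LEAST s. V (p2 r) (final_mark r) s else 0))"

text \<open>Membership is the default; only an enumerated witness of color \<open>c\<close> is
  dropped, which makes the set differ from the one enumerated with that index. The bound on
  \<open>r\<close> is justified by \<open>final_mark_ge\<close> and keeps the quantifier
  bounded.\<close>

definition target :: "nat \<Rightarrow> nat \<Rightarrow> bool" where
  "target c k \<longleftrightarrow> \<not> (\<exists>r<Suc k. final_mark r = k \<and> p1 r = c \<and> (\<exists>s. V (p2 r) k s))"

definition approx :: "nat \<Rightarrow> nat \<Rightarrow> nat \<Rightarrow> bool" where
  "approx c x k \<longleftrightarrow> \<not> (\<exists>r<Suc k. mark x r = k \<and> p1 r = c \<and> (\<exists>s<x. V (p2 r) k s))"

text \<open>The final marks cut the numbers into intervals; this is the requirement whose interval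
  contains \<open>x\<close>, and its color is given to stage \<open>x\<close>.\<close>

definition block :: "nat \<Rightarrow> nat" where
  "block x = (LEAST r. x < final_mark (Suc r))"

lemma stage_eq: "V e k s \<Longrightarrow> (LEAST s. V e k s) < x \<Longrightarrow> stage e k x = (LEAST s. V e k s)"
  unfolding stage_def
  by (rule Least_equality) (auto intro: LeastI Least_le)

lemma stage_none: "\<nexists>s. V e k s \<Longrightarrow> stage e k x = x"
  unfolding stage_def by (auto intro: Least_equality)

lemma final_mark_less_Suc: "final_mark r < final_mark (Suc r)"
  by simp

lemma strict_mono_final_mark: "strict_mono final_mark"
  using final_mark_less_Suc by (rule strict_mono_Suc_iff[THEN iffD2, rule_format])

lemma final_mark_mono: "r \<le> r' \<Longrightarrow> final_mark r \<le> final_mark r'"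
  using strict_mono_final_mark by (simp add: strict_mono_less_eq)

lemma final_mark_ge: "r \<le> final_mark r"
  using strict_mono_final_mark by (rule strict_mono_imp_increasing)

text \<open>By induction: if an earlier requirement acts at \<open>s\<close>, the final mark after
  it exceeds \<open>s\<close>, so stage \<open>x\<close> has already seen the action.\<close>

lemma mark_eq: "final_mark r \<le> x \<Longrightarrow> mark x r = final_mark r"
proof (induction r)
  case (Suc r)
  then have IH: "mark x r = final_mark r" by simp
  show ?case
  proof (cases "\<exists>s. V (p2 r) (final_mark r) s")
    case True
    then obtain s where s: "V (p2 r) (final_mark r) s" by blast
    have "(LEAST s. V (p2 r) (final_mark r) s) < x" using Suc.prems True by simp
    with stage_eq[OF s this] True show ?thesis by (simp add: IH next_mark_def)
  next
    case False
    with stage_none[OF False] show ?thesis by (simp add: IH next_mark_def)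
  qed
qed simp

lemma block_bounds: "final_mark (block x) \<le> x" "x < final_mark (Suc (block x))"
proof -
  have "x < final_mark (Suc x)" using final_mark_ge[of "Suc x"] by linarith
  then show "x < final_mark (Suc (block x))" unfolding block_def by (rule LeastI)
  show "final_mark (block x) \<le> x"
  proof (cases "block x")
    case (Suc r)
    then have "\<not> x < final_mark (Suc r)" unfolding block_def by (metis lessI not_less_Least)
    then show ?thesis unfolding Suc by simp
  qed simp
qed

lemma block_eqI: "final_mark r \<le> x \<Longrightarrow> x < final_mark (Suc r) \<Longrightarrow> block x = r"
  using block_bounds[of x] final_mark_mono[of "Suc r" "block x"] final_mark_mono[of "Suc (block x)" r]
  by (meson linorder_neqE_nat not_less_eq_eq order.trans not_le Suc_leI)

text \<open>Final marks are distinct, so \<open>pair c e\<close> is the only requirement that can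
  drop this number.\<close>

lemma target_iff: "\<not> target c (final_mark (pair c e)) \<longleftrightarrow> universal i e (final_mark (pair c e))"
proof -
  have "final_mark r = final_mark (pair c e) \<longleftrightarrow> r = pair c e" for r
    using strict_mono_eq[OF strict_mono_final_mark] by blast
  then show ?thesis using final_mark_ge[of "pair c e"]
    unfolding target_def universal_iff by (auto simp: less_Suc_eq_le)
qed

lemma not_sigma_target: "\<not> sigma {} (Suc i) (target c)"
proof
  assume "sigma {} (Suc i) (target c)"
  then obtain e where "\<forall>x. target c x \<longleftrightarrow> universal i e x" using universal_complete by blast
  with target_iff show False by blast
qed

text \<open>The number \<open>k\<close> is the witness of a requirement \<open>r\<close> that acts
  at some \<open>s\<close>. The next final mark exceeds \<open>s\<close>, so every stage from there
  on sees the action and rejects \<open>k\<close>; a wrong stage thus lies in the block of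
  \<open>r\<close>.\<close>

lemma approx_wrong:
  assumes "\<not> target c k" "k \<le> x" "approx c x k"
  shows "p1 (block x) = c \<and> final_mark (block x) = k"
proof -
  from assms(1) obtain r s where r: "r < Suc k" "final_mark r = k" "p1 r = c" and s: "V (p2 r) k s"
    unfolding target_def by blast
  have "x < final_mark (Suc r)"
  proof (rule ccontr)
    assume "\<not> x < final_mark (Suc r)"
    moreover have "\<exists>s. V (p2 r) (final_mark r) s" using r(2) s by blast
    ultimately have "(LEAST s. V (p2 r) k s) < x" using r(2) by simp
    moreover have "V (p2 r) k (LEAST s. V (p2 r) k s)" using s by (rule LeastI)
    moreover have "mark x r = k" using mark_eq[of r x] r(2) assms(2) by simp
    ultimately show False using assms(3) r unfolding approx_def by blast
  qed
  then have "block x = r" using r(2) assms(2) by (intro block_eqI) simp_all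
  with r show ?thesis by simp
qed

text \<open>From \<open>final_mark k\<close> on, all marks with index up to \<open>k\<close> are
  final, so \<open>approx\<close> can drop \<open>k\<close> only for a reason shared by
  \<open>target\<close>.\<close>

lemma approx_eventually:
  assumes "target c k" "final_mark k \<le> x"
  shows "approx c x k"
proof -
  have "mark x r = final_mark r" if "r < Suc k" for r
    using that assms(2) final_mark_mono[of r k] by (intro mark_eq) simp
  then show ?thesis using assms(1) unfolding target_def approx_def by metis
qed

text \<open>Ensures in \<open>limit_step\<close> that, for fixed initial arguments, only finitely
  many stages are overwritten.\<close>

lemma block_large: "final_mark (Suc b) \<le> x \<Longrightarrow> b < final_mark (block x)"
  using block_bounds(2)[of x] final_mark_mono[of "Suc (block x)" "Suc b"] final_mark_ge[of "block x"]
  by (metis Suc_le_mono not_le order.trans)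

lemma delta_fun_next_mark:
  assumes "delta_fun {} (Suc i) u" "delta_fun {} (Suc i) v" "delta_fun {} (Suc i) w"
  shows "delta_fun {} (Suc i) (\<lambda>e. next_mark (u e) (v e) (w e))"
proof -
  have "delta_fun {} (Suc i) (\<lambda>z. stage (p1 z) (p1 (p2 z)) (p2 (p2 z)))"
    unfolding stage_def
    by (rule delta_fun_Least, (rule delta_disj delta_V delta_eq delta_fun_intros | assumption)+) blast
  from delta_fun_comp[OF this, of "\<lambda>e. pair (p2 (v e)) (pair (w e) (u e))"]
  have "delta_fun {} (Suc i) (\<lambda>e. stage (p2 (v e)) (w e) (u e))"
    by (simp add: delta_fun_intros assms)
  then show ?thesis unfolding next_mark_def
    by (intro delta_fun_Suc delta_fun_add delta_fun_If delta_less assms delta_fun_const)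
qed

lemma delta_fun_mark:
  "delta_fun {} (Suc i) u \<Longrightarrow> delta_fun {} (Suc i) v \<Longrightarrow> delta_fun {} (Suc i) (\<lambda>e. mark (u e) (v e))"
  by (rule delta_fun_rec[where a = "\<lambda>_. 0" and h = next_mark])
    (simp_all add: delta_fun_const delta_fun_next_mark)

lemma delta_approx:
  "delta_fun {} (Suc i) u \<Longrightarrow> delta_fun {} (Suc i) v \<Longrightarrow> delta {} (Suc i) (\<lambda>e. approx c (u e) (v e))"
  unfolding approx_def
  by (rule delta_not delta_bex delta_conj delta_eq delta_V delta_fun_mark delta_fun_intros
    | assumption | rule delta_fun_comp, assumption)+

text \<open>The final marks are the limits of the marks, hence one level higher.\<close>

lemma final_mark_iff: "final_mark r = k \<longleftrightarrow> (\<exists>y. \<forall>x. y \<le> x \<longrightarrow> mark x r = k)"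
  using mark_eq[of r] by (metis nat_le_linear order.refl order.trans)

lemma delta_fun_final_mark: "delta_fun {} (Suc (Suc i)) final_mark"
proof -
  have "delta {} (Suc i) (\<lambda>w. p2 (p1 w) \<le> p2 w \<longrightarrow> mark (p2 w) (p1 (p1 (p1 w))) = p2 (p1 (p1 w)))"
    by (intro delta_imp delta_le delta_eq delta_fun_mark delta_fun_intros)
  from sigma_ex_pair[OF delta_sigma_not[OF this]]
  have "sigma {} (Suc i) (\<lambda>z. \<not> (\<forall>x. p2 z \<le> x \<longrightarrow> mark x (p1 (p1 z)) = p2 (p1 z)))" by simp
  from sigma_SucI[OF this] show ?thesis
    unfolding delta_fun_def final_mark_iff by simp
qed

lemma delta_target: "delta {} (Suc (Suc i)) (target c)"
proof -
  \<comment> \<open>The quantifier over \<open>s\<close> is that of \<open>universal\<close>, a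
    Sigma predicate of level \<open>i + 1\<close>, hence Delta one level up.\<close>
  have V: "delta {} (Suc (Suc i)) (\<lambda>z. \<exists>s. V (u z) (v z) s)"
    if uv: "delta_fun {} (Suc (Suc i)) u" "delta_fun {} (Suc (Suc i)) v" for u v
    using delta_subst[OF sigma_imp_delta_Suc[OF sigma_universal[of i]] delta_fun_pair[OF uv]]
    unfolding universal_iff by simp
  have "delta {} (Suc (Suc i)) (\<lambda>k. target c k)"
    unfolding target_def
    by (rule delta_not delta_bex delta_conj delta_eq V delta_fun_comp[OF delta_fun_final_mark] delta_fun_intros
      | assumption | rule delta_fun_comp, assumption)+
  then show ?thesis .
qed

lemma delta_fun_block: "delta_fun {} (Suc (Suc i)) block"
proof -
  have "delta_fun {} (Suc (Suc i)) (\<lambda>x. block x)"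
    unfolding block_def
    by (rule delta_fun_Least, (rule delta_less delta_fun_comp[OF delta_fun_final_mark]
       delta_fun_intros | assumption)+) (use block_bounds(2) in blast)
  then show ?thesis .
qed

end

text \<open>The interface to the construction: \<open>T c\<close> is the diagonal set of color
  \<open>c\<close>, \<open>A c x\<close> its approximation at stage \<open>x\<close>,
  \<open>H x\<close> the color of stage \<open>x\<close> and \<open>S x\<close> the start of its
  block. Index \<open>i\<close> serves the level \<open>i + 1\<close> of the theorem.\<close>

definition diagonal_level ::
    "nat \<Rightarrow> (nat \<Rightarrow> nat \<Rightarrow> bool) \<Rightarrow> (nat \<Rightarrow> nat \<Rightarrow> nat \<Rightarrow> bool) \<Rightarrow> (nat \<Rightarrow> nat) \<Rightarrow> (nat \<Rightarrow> nat) \<Rightarrow> bool" where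
  "diagonal_level i T A H S \<longleftrightarrow>
     (\<forall>c. delta {} (Suc (Suc i)) (T c) \<and> \<not> sigma {} (Suc i) (T c)) \<and>
     (\<forall>c u v. delta_fun {} (Suc i) u \<longrightarrow> delta_fun {} (Suc i) v \<longrightarrow>
        delta {} (Suc i) (\<lambda>e. A c (u e) (v e))) \<and>
     delta_fun {} (Suc (Suc i)) H \<and> delta_fun {} (Suc (Suc i)) S \<and>
     (\<forall>c k x. \<not> T c k \<longrightarrow> k \<le> x \<longrightarrow> A c x k \<longrightarrow> H x = c \<and> S x = k) \<and>
     (\<forall>c k. T c k \<longrightarrow> (\<exists>N. \<forall>x\<ge>N. A c x k)) \<and>
     (\<forall>b. \<exists>N. \<forall>x\<ge>N. b < S x)"

lemma diagonal_level_exists: "\<exists>T A H S. diagonal_level i T A H S"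
proof -
  obtain V where "diagonalization i V"
    using universal_witness[of i] unfolding diagonalization_def by metis
  then interpret diagonalization i V .
  have "delta_fun {} (Suc (Suc i)) (\<lambda>x. p1 (block x))" "delta_fun {} (Suc (Suc i)) (\<lambda>x. final_mark (block x))"
    by (intro delta_fun_p1 delta_fun_comp[OF delta_fun_final_mark] delta_fun_block)+
  then have "diagonal_level i target approx (\<lambda>x. p1 (block x)) (\<lambda>x. final_mark (block x))"
    unfolding diagonal_level_def
    using delta_target not_sigma_target delta_approx approx_wrong approx_eventually block_large
    by blast
  then show ?thesis by blast
qed

subsection \<open>Iterated limits\<close>

lemma limit_step:
  assumes level: "\<And>i. diagonal_level i (T i) (A i) (H i) (S i)"
    and F: "delta_fun {} (Suc (Suc j)) F"
  shows "\<exists>G. delta_fun {} (Suc j) G \<and>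
    (\<forall>a x. 0 < j \<longrightarrow> S (j - 1) x \<le> p2 a \<longrightarrow> G (pair a x) = H (j - 1) x) \<and>
    (\<forall>a. \<exists>N. \<forall>x\<ge>N. G (pair a x) = F a)"
proof -
  obtain L where L: "delta_fun {} (Suc j) L" "\<And>a. \<exists>N. \<forall>u\<ge>N. L (pair a u) = F a"
    using limit_lemma[OF F] by blast
  \<comment> \<open>\<open>H\<close> and \<open>S\<close> of index \<open>j - 1\<close> are Delta of
    level \<open>j + 1\<close>, exactly the complexity allowed for \<open>G\<close>. For
    \<open>j = 0\<close> nothing is overwritten.\<close>
  define G where "G z = (if 0 < j \<and> S (j - 1) (p2 z) \<le> p2 (p1 z) then H (j - 1) (p2 z) else L z)" for z
  have "delta_fun {} (Suc j) G"
  proof (cases j)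
    case 0
    then have "G = L" by (auto simp: G_def)
    with L(1) show ?thesis by simp
  next
    case (Suc k)
    have "delta_fun {} (Suc (Suc k)) (H k)" "delta_fun {} (Suc (Suc k)) (S k)"
      using level[of k] unfolding diagonal_level_def by blast+
    note HS = this[THEN delta_fun_comp]
    have "delta_fun {} (Suc (Suc k)) (\<lambda>z. if S k (p2 z) \<le> p2 (p1 z) then H k (p2 z) else L z)"
      by (intro delta_fun_If delta_le HS delta_fun_intros L(1)[unfolded Suc])
    moreover have "G = (\<lambda>z. if S k (p2 z) \<le> p2 (p1 z) then H k (p2 z) else L z)"
      by (rule ext) (simp add: G_def Suc)
    ultimately show ?thesis by (simp add: Suc)
  qed
  moreover have "\<exists>N. \<forall>x\<ge>N. G (pair a x) = F a" for a
  proof -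
    obtain N where N: "\<forall>x\<ge>N. L (pair a x) = F a" using L(2) by blast
    \<comment> \<open>Block starts tend to infinity, so from \<open>N'\<close> on the first case of
      \<open>G\<close> never applies.\<close>
    obtain N' where N': "\<forall>x\<ge>N'. p2 a < S (j - 1) x"
      using level[of "j - 1"] unfolding diagonal_level_def by blast
    have "G (pair a x) = F a" if "x \<ge> max N N'" for x
      using that N N'[rule_format, of x] by (simp add: G_def)
    then show ?thesis by blast
  qed
  moreover have "G (pair a x) = H (j - 1) x" if "0 < j" "S (j - 1) x \<le> p2 a" for a x
    using that by (simp add: G_def)
  ultimately show ?thesis by blast
qed

text \<open>The chain starts at \<open>j = n - 1\<close> with the coloring of index
  \<open>n - 2\<close> and descends by \<open>limit_step\<close>.\<close>

lemma limit_chain: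
  assumes level: "\<And>i. diagonal_level i (T i) (A i) (H i) (S i)" and n: "n > 1"
  obtains F where "\<And>j. j < n \<Longrightarrow> delta_fun {} (Suc j) (F j)"
    "\<And>j a x. j < n \<Longrightarrow> 0 < j \<Longrightarrow> Suc j = n \<or> S (j - 1) x \<le> p2 a \<Longrightarrow> F j (pair a x) = H (j - 1) x"
    "\<And>j a. Suc j < n \<Longrightarrow> \<exists>N. \<forall>x\<ge>N. F j (pair a x) = F (Suc j) a"
proof -
  \<comment> \<open>\<open>d = n - 1 - j\<close> counts the descent, so that dependent choice
    applies; the guards on \<open>d\<close> in \<open>P\<close> and \<open>Q\<close> make all later
    steps vacuous.\<close>
  define P where "P d G \<longleftrightarrow> (d < n \<longrightarrow> delta_fun {} (n - d) G \<and> (\<forall>a x. 0 < n - Suc d \<longrightarrow>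
    d = 0 \<or> S (n - Suc d - 1) x \<le> p2 a \<longrightarrow> G (pair a x) = H (n - Suc d - 1) x))" for d and G :: "nat \<Rightarrow> nat"
  define Q where "Q d G G' \<longleftrightarrow> (Suc d < n \<longrightarrow> (\<forall>a. \<exists>N. \<forall>x\<ge>N. G' (pair a x) = G a))"
    for d and G G' :: "nat \<Rightarrow> nat"
  have "\<exists>G. P 0 G"
  proof -
    have "delta_fun {} (Suc (Suc (n - 2))) (\<lambda>z. H (n - 2) (p2 z))"
      using level[of "n - 2"] delta_fun_comp[OF _ delta_fun_p2[OF delta_fun_id]]
      unfolding diagonal_level_def by blast
    moreover have "Suc (Suc (n - 2)) = n" "n - Suc 0 - 1 = n - 2" using n by simp_all
    ultimately show ?thesis by (intro exI[of _ "\<lambda>z. H (n - 2) (p2 z)"]) (simp add: P_def)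
  qed
  moreover have "\<exists>G'. P (Suc d) G' \<and> Q d G G'" if "P d G" for d G
  proof (cases "Suc d < n")
    case True
    then obtain j where j: "n = Suc (Suc (d + j))" using less_iff_Suc_add by auto
    have "delta_fun {} (Suc (Suc j)) G" using that True by (simp add: P_def j Suc_diff_le)
    from limit_step[where H = H, OF level this] show ?thesis
      unfolding P_def Q_def by (simp add: j)
  qed (auto simp: P_def Q_def)
  ultimately obtain G where G: "\<And>d. P d (G d)" "\<And>d. Q d (G d) (G (Suc d))"
    using dependent_nat_choice[of P Q] by blast
  show ?thesis
  proof (rule that[of "\<lambda>j. G (n - Suc j)"])
    fix j assume "j < n"
    then have *: "n - (n - Suc j) = Suc j" "n - Suc (n - Suc j) = j" "n - Suc j < n"
      "n - Suc j = 0 \<longleftrightarrow> Suc j = n" by auto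
    show "delta_fun {} (Suc j) (G (n - Suc j))"
      using G(1)[of "n - Suc j"] *(3) unfolding P_def *(1,2) by blast
    fix a x assume "0 < j" "Suc j = n \<or> S (j - 1) x \<le> p2 a"
    then show "G (n - Suc j) (pair a x) = H (j - 1) x"
      using G(1)[of "n - Suc j"] *(3) unfolding P_def *(1,2,4) by blast
  next
    fix j a assume j: "Suc j < n"
    then have "Suc (n - Suc (Suc j)) = n - Suc j" "Suc (n - Suc (Suc j)) < n" by simp_all
    then show "\<exists>N. \<forall>x\<ge>N. G (n - Suc j) (pair a x) = G (n - Suc (Suc j)) a"
      using G(2)[of "n - Suc (Suc j)"] unfolding Q_def by metis
  qed
qed

section \<open>Functions on finite sets via codes of tuples\<close>

definition tuple_code :: "nat list \<Rightarrow> nat" where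
  "tuple_code xs = foldl pair 0 xs"

text \<open>Nesting to the left puts the last entry outermost, so \<open>p2\<close> reads it off and
  passing to a limit removes it.\<close>

lemma tuple_code_snoc: "tuple_code (xs @ [x]) = pair (tuple_code xs) x"
  by (simp add: tuple_code_def)

text \<open>One pairing per entry; the program depends on the fixed arity \<open>n\<close>.\<close>

lemma evals_tuple_code: "\<exists>p. \<forall>xs. length xs = n \<longrightarrow> evals X p xs (tuple_code xs)"
proof -
  obtain q where q: "\<And>a b. evals X q [a, b] (pair a b)"
    using computable2_pairI[OF computable_id] unfolding computable2_def by blast
  have "m \<le> n \<Longrightarrow> \<exists>p. \<forall>xs. length xs = n \<longrightarrow> evals X p xs (tuple_code (take m xs))" for m
  proof (induction m)
    case 0
    then show ?case by (auto intro!: exI[of _ Zero] evals.intros simp: tuple_code_def)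
  next
    case (Suc m)
    then obtain p where p: "\<And>xs. length xs = n \<Longrightarrow> evals X p xs (tuple_code (take m xs))" by auto
    have "evals X (Comp q [p, Proj m]) xs (tuple_code (take (Suc m) xs))" if "length xs = n" for xs
      unfolding take_Suc_conv_app_nth[OF Suc.prems[unfolded Suc_le_eq that[symmetric]]] tuple_code_snoc
      by (rule evals_Comp2[OF p[OF that] evals_Proj q]) (use Suc.prems that in auto)
    then show ?case by blast
  qed
  from this[of n] show ?thesis by auto
qed

definition tuple_fun :: "(nat \<Rightarrow> nat) \<Rightarrow> nat set \<Rightarrow> nat" where
  "tuple_fun h \<sigma> = h (tuple_code (sorted_list_of_set \<sigma>))"

lemma tuple_fun_set: "sorted_wrt (<) xs \<Longrightarrow> tuple_fun h (set xs) = h (tuple_code xs)"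
  by (simp add: tuple_fun_def sorted_list_of_set.idem_if_sorted_distinct strict_sorted_iff)

lemma computable_tuple_fun:
  assumes "computable {} h"
  shows "computable_on_nsets n (tuple_fun h)"
proof -
  obtain p where p: "\<And>x. evals {} p [x] (h x)" using assms unfolding computable_def by blast
  obtain q where q: "\<And>xs. length xs = n \<Longrightarrow> evals {} q xs (tuple_code xs)"
    using evals_tuple_code by blast
  have "evals {} (Comp p [q]) (sorted_list_of_set \<sigma>) (tuple_fun h \<sigma>)" if "\<sigma> \<in> nsets UNIV n" for \<sigma>
    unfolding tuple_fun_def by (rule evals_Comp1[OF q p]) (use that in \<open>auto simp: nsets_def\<close>)
  then show ?thesis unfolding computable_on_nsets_def by blast
qed

lemma sorted_list_of_set_obtain:
  assumes "finite (\<sigma> :: nat set)"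
  obtains xs where "sorted_wrt (<) xs" "set xs = \<sigma>" "length xs = card \<sigma>"
  using that[of "sorted_list_of_set \<sigma>"] assms by simp

lemma stable_tuple_fun:
  assumes "\<And>a. \<exists>N. \<forall>x\<ge>N. h (pair a x) = h' a"
  shows "stable_on_nsets n (tuple_fun h)"
  unfolding stable_on_nsets_def
proof
  fix \<sigma> :: "nat set" assume "\<sigma> \<in> nsets UNIV (n - 1)"
  then have "finite \<sigma>" by (simp add: nsets_def)
  then obtain xs where xs: "sorted_wrt (<) xs" "set xs = \<sigma>" "length xs = card \<sigma>" by (rule sorted_list_of_set_obtain)
  obtain N where N: "\<forall>x\<ge>N. h (pair (tuple_code xs) x) = h' (tuple_code xs)" using assms by blast
  \<comment> \<open>Beyond the maximum of the set, \<open>x\<close> becomes the last entry; the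
    inserted 0 keeps \<open>Max\<close> defined for the empty set.\<close>
  have "tuple_fun h (insert x \<sigma>) = h' (tuple_code xs)" if x: "x \<ge> max N (Suc (Max (insert 0 \<sigma>)))" for x
  proof -
    have "\<forall>y\<in>set xs. y < x" using x \<open>finite \<sigma>\<close> xs(2) by (auto simp: Suc_le_eq)
    then have "sorted_wrt (<) (xs @ [x])" using xs(1) by (simp add: sorted_wrt_append)
    moreover have "set (xs @ [x]) = insert x \<sigma>" using xs(2) by simp
    ultimately have "tuple_fun h (insert x \<sigma>) = h (pair (tuple_code xs) x)"
      using tuple_fun_set tuple_code_snoc by metis
    with N x show ?thesis by simp
  qed
  then have "eventually (\<lambda>x. tuple_fun h (insert x \<sigma>) = h' (tuple_code xs)) sequentially"
    unfolding eventually_sequentially by blast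
  then show "convergent (\<lambda>x. tuple_fun h (insert x \<sigma>))"
    by (rule convergentI[OF tendsto_eventually])
qed

section \<open>Infinite thin sets enumerate diagonal sets\<close>

lemma thin_avoids:
  fixes X :: "nat set"
  assumes "infinite X" and c: "c \<notin> tuple_fun (F 0) ` nsets X n"
    and lim: "\<And>j a. Suc j < n \<Longrightarrow> \<exists>N. \<forall>x\<ge>N. F j (pair a x) = F (Suc j) a"
  shows "j < n \<Longrightarrow> sorted_wrt (<) xs \<Longrightarrow> set xs \<subseteq> X \<Longrightarrow> length xs = n - j \<Longrightarrow> F j (tuple_code xs) \<noteq> c"
proof (induction j arbitrary: xs)
  case 0
  have "set xs \<in> nsets X n"
    using 0 by (simp add: nsets_def distinct_card strict_sorted_iff)
  then have "tuple_fun (F 0) (set xs) \<noteq> c" using c by blast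
  with 0 show ?case by (simp add: tuple_fun_set)
next
  case (Suc j)
  obtain N where N: "\<forall>x\<ge>N. F j (pair (tuple_code xs) x) = F (Suc j) (tuple_code xs)"
    using lim[OF Suc.prems(1)] by blast
  \<comment> \<open>As \<open>X\<close> is infinite, the limit value is attained at some
    \<open>x\<close> in \<open>X\<close> beyond \<open>xs\<close>, hence on a longer tuple from
    \<open>X\<close>, where \<open>c\<close> is avoided.\<close>
  obtain x where x: "x \<in> X" "x > max N (Max (insert 0 (set xs)))"
    using \<open>infinite X\<close> unfolding infinite_nat_iff_unbounded by blast
  have "\<forall>y\<in>set xs. y < x" using x by auto
  then have "F j (tuple_code (xs @ [x])) \<noteq> c"
    using Suc.prems x by (intro Suc.IH) (auto simp: sorted_wrt_append)
  then show ?case using N x by (simp add: tuple_code_snoc)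
qed

lemma thin_function_exists:
  assumes "n > 1"
  shows "\<exists>h. computable {} h \<and> stable_on_nsets n (tuple_fun h) \<and>
    (\<forall>i X. 0 < i \<and> i < n \<and> infinite X \<and> thin n (tuple_fun h) X \<longrightarrow>
       (\<exists>T. delta {} (Suc i) T \<and> \<not> sigma {} i T \<and> sigma X i T))"
proof -
  obtain T A H S where level: "\<And>i. diagonal_level i (T i) (A i) (H i) (S i)"
    using diagonal_level_exists by metis
  obtain F where F: "\<And>j. j < n \<Longrightarrow> delta_fun {} (Suc j) (F j)"
    "\<And>j a x. j < n \<Longrightarrow> 0 < j \<Longrightarrow> Suc j = n \<or> S (j - 1) x \<le> p2 a \<Longrightarrow> F j (pair a x) = H (j - 1) x"
    "\<And>j a. Suc j < n \<Longrightarrow> \<exists>N. \<forall>x\<ge>N. F j (pair a x) = F (Suc j) a"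
    using limit_chain[where H = H and S = S, OF level assms] by blast
  have "computable {} (F 0)" using F(1)[of 0] assms by (intro computable_of_delta_fun) simp
  moreover have "stable_on_nsets n (tuple_fun (F 0))"
    using F(3)[of 0] assms by (intro stable_tuple_fun[of _ "F (Suc 0)"]) simp
  moreover have "\<exists>B. delta {} (Suc i) B \<and> \<not> sigma {} i B \<and> sigma X i B"
    if i: "0 < i" "i < n" and X: "infinite X" "thin n (tuple_fun (F 0)) X" for i X
  proof -
    obtain c where c: "c \<notin> tuple_fun (F 0) ` nsets X n" using X(2) unfolding thin_def by blast
    note avoid = thin_avoids[where F = F, OF X(1) c F(3) i(2)]
    obtain k where k: "i = Suc k" using i(1) by (cases i) auto
    note level_k = level[of k, unfolded diagonal_level_def]
    \<comment> \<open>The color \<open>c\<close> is avoided at suitable tuples ending in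
      \<open>x\<close>. Below the top level \<open>y\<close> is the last but one entry, which is
      \<open>p2 a\<close>; at the top \<open>x\<close> is the only argument.\<close>
    have "\<exists>N. \<forall>y x. y \<in> X \<and> x \<in> X \<and> N \<le> y \<and> y < x \<longrightarrow> (\<exists>a. (Suc i = n \<or> p2 a = y) \<and> F i (pair a x) \<noteq> c)"
    proof (cases "Suc i = n")
      case True
      have "F i (pair 0 x) \<noteq> c" if "x \<in> X" for x
        using avoid[of "[x]"] that True by (auto simp: tuple_code_def)
      then show ?thesis using True by blast
    next
      case False
      \<comment> \<open>Together with \<open>y\<close> and \<open>x\<close> these make up the
        \<open>n - i\<close> arguments of \<open>F i\<close>; they stay fixed while \<open>y\<close>
        and \<open>x\<close> vary.\<close>
      obtain R where R: "finite R" "card R = n - i - 2" "R \<subseteq> X"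
        using infinite_arbitrarily_large[OF X(1)] by blast
      obtain xs where xs: "sorted_wrt (<) xs" "set xs = R" "length xs = card R"
        by (rule sorted_list_of_set_obtain[OF R(1)])
      have "F i (pair (pair (tuple_code xs) y) x) \<noteq> c"
        if "y \<in> X" "x \<in> X" "Suc (Max (insert 0 R)) \<le> y" "y < x" for y x
      proof -
        have "\<forall>z\<in>set xs. z < y" using that(3) R(1) xs(2) by (auto simp: Suc_le_eq)
        then have "sorted_wrt (<) ((xs @ [y]) @ [x])" using xs(1) that(4) by (auto simp: sorted_wrt_append)
        moreover have "length ((xs @ [y]) @ [x]) = n - i" using False i(2) xs(3) R(2) by simp
        ultimately have "F i (tuple_code ((xs @ [y]) @ [x])) \<noteq> c"
          using that R(3) xs(2) by (intro avoid) auto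
        then show ?thesis unfolding tuple_code_snoc .
      qed
      then show ?thesis by (metis p2_pair)
    qed
    then obtain N where N: "\<And>y x. y \<in> X \<Longrightarrow> x \<in> X \<Longrightarrow> N \<le> y \<Longrightarrow> y < x \<Longrightarrow>
      \<exists>a. (Suc i = n \<or> p2 a = y) \<and> F i (pair a x) \<noteq> c" by blast
    \<comment> \<open>A stage in \<open>X\<close> whose approximation contains \<open>m\<close> is
      reliable if some large \<open>y\<close> in \<open>X\<close> with \<open>m \<le> y\<close> lies
      below it: a wrong stage would have color \<open>c\<close> and a block starting at
      \<open>m\<close>.\<close>
    have iff: "T k c m \<longleftrightarrow> (\<exists>y x. y \<in> X \<and> x \<in> X \<and> N \<le> y \<and> m \<le> y \<and> y < x \<and> A k c x m)" for m
    proof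
      assume "T k c m"
      then obtain N' where N': "\<forall>x\<ge>N'. A k c x m" using level_k by blast
      obtain y where "y \<in> X" "y > max N m" using X(1) unfolding infinite_nat_iff_unbounded by blast
      moreover obtain x where "x \<in> X" "x > max N' y" using X(1) unfolding infinite_nat_iff_unbounded by blast
      ultimately show "\<exists>y x. y \<in> X \<and> x \<in> X \<and> N \<le> y \<and> m \<le> y \<and> y < x \<and> A k c x m"
        using N' by (intro exI[of _ y] exI[of _ x]) auto
    next
      assume "\<exists>y x. y \<in> X \<and> x \<in> X \<and> N \<le> y \<and> m \<le> y \<and> y < x \<and> A k c x m"
      then obtain y x where yx: "y \<in> X" "x \<in> X" "N \<le> y" "m \<le> y" "y < x" "A k c x m" by blast
      show "T k c m"
      proof (rule ccontr)
        assume "\<not> T k c m"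
        moreover have "m \<le> x" using yx by simp
        ultimately have HS: "H k x = c" "S k x = m" using level_k yx(6) by blast+
        obtain a where a: "Suc i = n \<or> p2 a = y" "F i (pair a x) \<noteq> c" using N yx by blast
        \<comment> \<open>The block of \<open>x\<close> starts at \<open>m\<close>, which is at most
          \<open>y\<close>, so below the top level \<open>F i\<close> was overwritten by the color
          of \<open>x\<close>; at the top it is that color anyway.\<close>
        have "F i (pair a x) = H (i - 1) x" using a(1) yx(4) HS(2) i k by (intro F(2)) auto
        then show False using a(2) HS(1) k by simp
      qed
    qed
    have mem: "delta X (Suc k) (\<lambda>e. u e \<in> X)" if "delta_fun X (Suc k) u" for u
    proof -
      have "decidable X (\<lambda>x. x \<in> X)"
        unfolding decidable_def computable_def by (blast intro: evals.intros)
      from delta_subst[OF decidable_imp_delta[OF this] that] show ?thesis .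
    qed
    have A: "delta X (Suc k) (\<lambda>e. A k c (u e) (v e))" if uv: "delta_fun X (Suc k) u" "delta_fun X (Suc k) v" for u v
    proof -
      have "delta {} (Suc k) (\<lambda>e. A k c (p1 e) (p2 e))"
        using level_k delta_fun_p1[OF delta_fun_id] delta_fun_p2[OF delta_fun_id] by blast
      from delta_subst[OF delta_mono[OF empty_turing_le this] delta_fun_pair[OF uv]] show ?thesis by simp
    qed
    have "sigma X (Suc k) (\<lambda>m. T k c m)"
      unfolding iff
      by (rule sigma_ex sigma_conj delta_sigma[OF mem] delta_sigma[OF delta_le] delta_sigma[OF delta_less]
        delta_sigma[OF A] delta_fun_intros | assumption | rule delta_fun_comp, assumption)+
    then show ?thesis using level_k unfolding k by blast
  qed
  ultimately show ?thesis by blast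
qed

section \<open>Computability of the graph code\<close>

text \<open>Besides the code of a tuple, the recursion tracks the code \<open>a\<close> of the entries read so far
  and a lower bound \<open>b\<close> for the remaining ones.\<close>

primrec graph_rel :: "(nat \<Rightarrow> nat) \<Rightarrow> nat \<Rightarrow> nat \<Rightarrow> nat \<Rightarrow> nat \<Rightarrow> nat \<Rightarrow> bool" where
  "graph_rel h 0 l a b v \<longleftrightarrow> l = 0 \<and> h a = v"
| "graph_rel h (Suc n) l a b v \<longleftrightarrow> (\<exists>x<l. \<exists>l'<l. l = Suc (pair x l') \<and> b \<le> x \<and> graph_rel h n l' (pair a x) (Suc x) v)"

lemma graph_rel_iff:
  "graph_rel h n l a b v \<longleftrightarrow> (\<exists>xs. length xs = n \<and> l = list_encode xs \<and> sorted_wrt (<) xs \<and>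
     (\<forall>x\<in>set xs. b \<le> x) \<and> h (foldl pair a xs) = v)"
proof (induction n arbitrary: l a b)
  case (Suc n)
  show ?case
  proof
    assume "graph_rel h (Suc n) l a b v"
    then obtain x xs where "l = Suc (pair x (list_encode xs))" "b \<le> x" "length xs = n" "sorted_wrt (<) xs"
      "\<forall>y\<in>set xs. Suc x \<le> y" "h (foldl pair (pair a x) xs) = v"
      by (auto simp: Suc.IH)
    then show "\<exists>xs. length xs = Suc n \<and> l = list_encode xs \<and> sorted_wrt (<) xs \<and>
     (\<forall>x\<in>set xs. b \<le> x) \<and> h (foldl pair a xs) = v"
      by (intro exI[of _ "x # xs"]) auto
  next
    assume "\<exists>xs. length xs = Suc n \<and> l = list_encode xs \<and> sorted_wrt (<) xs \<and>
     (\<forall>x\<in>set xs. b \<le> x) \<and> h (foldl pair a xs) = v"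
    then obtain x xs where xs: "length xs = n" "l = Suc (pair x (list_encode xs))" "sorted_wrt (<) xs"
      "\<forall>y\<in>set xs. Suc x \<le> y" "b \<le> x" "h (foldl pair (pair a x) xs) = v"
      by (auto simp: length_Suc_conv Suc_le_eq)
    then have "graph_rel h n (list_encode xs) (pair a x) (Suc x) v" unfolding Suc.IH by blast
    moreover have "x < l" "list_encode xs < l"
      using xs(2) le_prod_encode_1[of x "list_encode xs"] le_prod_encode_2[of "list_encode xs" x] by simp_all
    ultimately show "graph_rel h (Suc n) l a b v" using xs(2,5) by auto
  qed
qed auto

lemma delta_graph_rel:
  assumes h: "delta_fun X (Suc i) h"
  shows "delta_fun X (Suc i) l \<Longrightarrow> delta_fun X (Suc i) a \<Longrightarrow> delta_fun X (Suc i) b \<Longrightarrow> delta_fun X (Suc i) v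
    \<Longrightarrow> delta X (Suc i) (\<lambda>e. graph_rel h n (l e) (a e) (b e) (v e))"
proof (induction n arbitrary: l a b v)
  case 0
  then show ?case unfolding graph_rel.simps
    by (intro delta_conj delta_eq delta_fun_comp[OF h] delta_fun_const)
next
  case (Suc n)
  show ?case unfolding graph_rel.simps
    by (rule delta_bex delta_conj delta_eq delta_le Suc.IH delta_fun_intros Suc.prems
       Suc.prems[THEN delta_fun_comp] | assumption | rule delta_fun_comp, assumption)+
qed

text \<open>Allows the instance of preservation in which \<open>X\<close> is this graph code and
  \<open>Z\<close> is empty.\<close>

lemma graph_code_computable:
  assumes "computable {} h"
  shows "graph_code n (tuple_fun h) \<le>\<^sub>T {}"
proof -
  have "z \<in> graph_code n (tuple_fun h) \<longleftrightarrow> graph_rel h n (p1 z) 0 0 (p2 z)" for z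
  proof
    assume "z \<in> graph_code n (tuple_fun h)"
    then obtain \<sigma> where s: "\<sigma> \<in> nsets UNIV n" "z = pair (list_encode (sorted_list_of_set \<sigma>)) (tuple_fun h \<sigma>)"
      unfolding graph_code_def by blast
    then show "graph_rel h n (p1 z) 0 0 (p2 z)"
      unfolding graph_rel_iff 
      by (intro exI[of _ "sorted_list_of_set \<sigma>"]) (simp add: nsets_def tuple_fun_def tuple_code_def)
  next
    assume "graph_rel h n (p1 z) 0 0 (p2 z)"
    then obtain xs where xs: "length xs = n" "p1 z = list_encode xs" "sorted_wrt (<) xs" "h (tuple_code xs) = p2 z"
      unfolding graph_rel_iff tuple_code_def by blast
    have "set xs \<in> nsets UNIV n"
      using xs by (simp add: nsets_def distinct_card strict_sorted_iff)
    moreover have "z = pair (list_encode (sorted_list_of_set (set xs))) (tuple_fun h (set xs))"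
      using xs pair_p1_p2[of z] by (simp add: tuple_fun_set sorted_list_of_set.idem_if_sorted_distinct strict_sorted_iff)
    ultimately show "z \<in> graph_code n (tuple_fun h)" unfolding graph_code_def by blast
  qed
  then have "delta {} (Suc 0) (\<lambda>z. z \<in> graph_code n (tuple_fun h))"
    by (simp add: delta_graph_rel computable_imp_delta_fun[OF assms] delta_fun_intros)
  from decidable_of_delta[OF this] show ?thesis
    by (simp add: decidable_def computable_def turing_le_def)
qed

section \<open>Failure of preservation\<close>

lemma turing_le_join: "Y \<le>\<^sub>T {} \<oplus> Y"
proof -
  have "decidable ({} \<oplus> Y) (\<lambda>x. x \<in> {} \<oplus> Y)"
    unfolding decidable_def computable_def by (blast intro: evals.intros)
  from decidable_subst[OF this, of "\<lambda>x. 2 * x + 1"]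
  have "decidable ({} \<oplus> Y) (\<lambda>x. 2 * x + 1 \<in> {} \<oplus> Y)"
    by (simp add: computable_intros)
  moreover have "2 * x + 1 \<in> {} \<oplus> Y \<longleftrightarrow> x \<in> Y" for x by (auto simp: join_def)
  ultimately show ?thesis by (simp add: turing_le_def decidable_def computable_def)
qed

text \<open>An index for this predicate would yield a contradiction when applied to itself.\<close>

lemma not_pi_universal: "\<not> sigma {} (Suc i) (\<lambda>x. \<not> universal i x x)"
  using universal_complete by blast

text \<open>The set witnessing the failure must avoid both classes of level \<open>i\<close>, so the given set is
  combined with one that is enumerable but not co-enumerable at that level.\<close>

lemma not_preserves:
  assumes T: "delta {} (Suc (Suc i)) T" "\<not> sigma {} (Suc i) T" "sigma Y (Suc i) T"
  shows "\<not> preserves_Delta0_Suc (Suc i) {} Y"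
proof
  assume pres: "preserves_Delta0_Suc (Suc i) {} Y"
  define U where "U z \<longleftrightarrow> universal i z z" for z
  \<comment> \<open>A disjoint sum: tag 0 holds \<open>T\<close>, which excludes Sigma, and the
    other tags hold \<open>U\<close>, which excludes Pi.\<close>
  define B where "B z \<longleftrightarrow> (p1 z = 0 \<and> T (p2 z)) \<or> (p1 z \<noteq> 0 \<and> U (p2 z))" for z
  have U: "sigma {} (Suc i) U"
    unfolding U_def using sigma_subst[OF sigma_universal[of i] computable_pair[OF computable_id computable_id]] by simp
  note intros = delta_disj delta_conj delta_not delta_eq delta_fun_p1 delta_fun_id delta_fun_const
    delta_fun_p2
  have "delta {} (Suc (Suc i)) (\<lambda>z. B z)" unfolding B_def
    by (intro intros delta_subst[OF T(1)] delta_subst[OF sigma_imp_delta_Suc[OF U]])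
  then have 1: "Delta0 (Suc i + 1) {} {z. B z}"
    by (simp add: delta_def Delta0_def Pi0_def sigma_def Collect_neg_eq)
  have 2: "\<not> Sigma0 (Suc i) {} {z. B z}"
  proof
    assume "Sigma0 (Suc i) {} {z. B z}"
    then have "sigma {} (Suc i) B" by (simp add: sigma_def)
    from sigma_subst[OF this, of "\<lambda>x. pair 0 x"] have "sigma {} (Suc i) T"
      by (simp add: B_def computable_intros)
    with T(2) show False ..
  qed
  have 3: "\<not> Pi0 (Suc i) {} {z. B z}"
  proof
    assume "Pi0 (Suc i) {} {z. B z}"
    then have "sigma {} (Suc i) (\<lambda>z. \<not> B z)" by (simp add: sigma_def Pi0_def Collect_neg_eq)
    from sigma_subst[OF this, of "\<lambda>x. pair 1 x"] have "sigma {} (Suc i) (\<lambda>x. \<not> U x)"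
      by (simp add: B_def computable_intros)
    with not_pi_universal[of i] show False by (simp add: U_def)
  qed
  have "sigma Y (Suc i) (\<lambda>z. B z)" unfolding B_def
    by (intro sigma_disj sigma_conj sigma_subst_fun[OF T(3)] sigma_subst_fun[OF sigma_mono[OF empty_turing_le U]]
      delta_sigma[OF delta_eq] delta_sigma_not[OF delta_eq] delta_fun_p1 delta_fun_p2 delta_fun_id delta_fun_const)
  from sigma_mono[OF turing_le_join this] have "Sigma0 (Suc i) ({} \<oplus> Y) {z. B z}"
    by (simp add: sigma_def)
  with pres 1 2 3 show False
    unfolding preserves_Delta0_Suc_def properly_Delta0_Suc_def by blast
qed

theorem theorem4p3:
  fixes n :: nat
  assumes "n > 1"
  shows "(\<exists>f :: nat set \<Rightarrow> nat. computable_on_nsets n f \<and> stable_on_nsets n f \<and>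
            (\<forall>i X. 0 < i \<and> i < n \<and> infinite X \<and> thin n f X \<longrightarrow>
               (\<exists>B. Delta0 (i + 1) {} B \<and> \<not> Sigma0 i {} B \<and> Sigma0 i X B)))
       \<and> (\<forall>i. 0 < i \<and> i < n \<longrightarrow>
            \<not> admits_preservation_Delta0_Suc i (STS n) \<and>
            \<not> admits_preservation_Delta0_Suc i (TS n))"
proof -
  obtain h where h: "computable {} h" "stable_on_nsets n (tuple_fun h)"
    and *: "\<forall>i X. 0 < i \<and> i < n \<and> infinite X \<and> thin n (tuple_fun h) X \<longrightarrow>
       (\<exists>T. delta {} (Suc i) T \<and> \<not> sigma {} i T \<and> sigma X i T)"
    using thin_function_exists[OF assms] by blast
  have T: "\<exists>T. delta {} (Suc i) T \<and> \<not> sigma {} i T \<and> sigma X i T"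
    if "0 < i" "i < n" "infinite X" "thin n (tuple_fun h) X" for i X
    using *[THEN spec, THEN spec, THEN mp, OF conjI[OF that(1) conjI[OF that(2) conjI[OF that(3,4)]]]] .
  have B: "\<exists>B. Delta0 (i + 1) {} B \<and> \<not> Sigma0 i {} B \<and> Sigma0 i X B"
    if iX: "0 < i" "i < n" "infinite X" "thin n (tuple_fun h) X" for i X
  proof -
    obtain T where "delta {} (Suc i) T" "\<not> sigma {} i T" "sigma X i T" using T[OF iX] by blast
    then show ?thesis
      by (intro exI[of _ "{z. T z}"]) (simp add: delta_def Delta0_def Pi0_def sigma_def Collect_neg_eq)
  qed
  \<comment> \<open>Both principles enter only through the fact that their solutions for this graph
    code are infinite thin sets.\<close>
  have not_admits: "\<not> admits_preservation_Delta0_Suc i \<phi>"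
    if i: "0 < i" "i < n"
      and phi: "\<And>Y. \<phi> (graph_code n (tuple_fun h)) Y \<Longrightarrow> infinite Y \<and> thin n (tuple_fun h) Y" for i \<phi>
  proof
    assume "admits_preservation_Delta0_Suc i \<phi>"
    then obtain Y where Y: "\<phi> (graph_code n (tuple_fun h)) Y" "preserves_Delta0_Suc i {} Y"
      unfolding admits_preservation_Delta0_Suc_def using graph_code_computable[OF h(1)] by blast
    obtain T where "delta {} (Suc i) T" "\<not> sigma {} i T" "sigma Y i T"
      using T[OF i] phi[OF Y(1)] by blast
    \<comment> \<open>The level in \<open>not_preserves\<close> is written \<open>Suc i\<close>,
      hence the shift by one.\<close>
    with not_preserves[of "i - 1" T Y] Y(2) i(1) show False by simp
  qed
  show ?thesis
  proof (intro conjI exI[of _ "tuple_fun h"] allI impI)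
    show "computable_on_nsets n (tuple_fun h)" by (rule computable_tuple_fun[OF h(1)])
    show "stable_on_nsets n (tuple_fun h)" by (rule h(2))
  next
    fix i X assume "0 < i \<and> i < n \<and> infinite X \<and> thin n (tuple_fun h) X"
    then show "\<exists>B. Delta0 (i + 1) {} B \<and> \<not> Sigma0 i {} B \<and> Sigma0 i X B" using B by simp
  next
    fix i assume "0 < i \<and> i < n"
    then show "\<not> admits_preservation_Delta0_Suc i (STS n)" "\<not> admits_preservation_Delta0_Suc i (TS n)"
      using h(2) not_admits[of i "STS n"] not_admits[of i "TS n"] by (simp_all add: STS_def TS_def)
  qed
qed

end
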